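(* Let $(X,x)$ be a pointed Kan complex and $n \ge 0$. The natural bijection between the set of relative cubical maps $(\square^n, \partial\square^n) \to (X,x)$ and the set $\Omega^n(X,x)_0$ of $0$-cubes of the $n$-th loop space (sending $f \colon \square^n \to X$ to the $0$-cube of $\Omega^n(X,x)$ represented by the $n$-cube $f$) induces a bijection $$[(\square^n, \partial\square^n), (X,x)] \cong \pi_n(X,x),$$ natural in $(X,x)$, where the left-hand side is the set of relative homotopy classes of relative cubical maps.
   Context: Cubes: $\square$ is the category whose objects are the posets $[1]^n=\{0\le 1\}^n$, $n\ge 0$, with morphisms generated under composition (inside posets) by the faces $\partial_{i,\varepsilon}\colon [1]^{n-1}\to[1]^n$ inserting $\varepsilon\in\{0,1\}$ as $i$-th coordinate ($1\le i\le n$), the degeneracies $\sigma_i\colon[1]^n\to[1]^{n-1}$ deleting the $i$-th coordinate ($1\le i\le n$), and the connections $\gamma_{i,0},\gamma_{i,1}\colon[1]^n\to[1]^{n-1}$ ($1\le i\le n-1$) replacing the coordinates $x_i,x_{i+1}$ by their maximum, resp. minimum. A cubical set is a functor $X\colon\square^{op}\to\mathsf{Set}$; $X_n=X([1]^n)$, and operators act on the right. $\square^n$ is the representable at $[1]^n$; $\partial\square^n\subseteq\square^n$ is the union of the images of all faces; the open box $\sqcap^n_{i,\varepsilon}$ is the union of the images of all faces $\partial_{j,\eta}$ with $(j,\eta)\ne(i,\varepsilon)$. The geometric product $\otimes$ on cubical sets is the left Kan extension of $[1]^m\otimes[1]^n=[1]^{m+n}$ (so $\square^m\otimes\square^n=\square^{m+n}$),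 and $\hom_R(X,-)$ is the right adjoint of $X\otimes -$. A Kan complex is a cubical set $X$ such that every map $\sqcap^n_{i,\varepsilon}\to X$ extends to $\square^n\to X$ (all $n\ge1$, $i$, $\varepsilon$). Loop spaces: for a pointed cubical set $(X,x)$, $\Omega(X,x)$ is the pullback of $(x,x)\colon\square^0\to X\times X$ along $(\partial_{1,0}^*,\partial_{1,1}^* )\colon\hom_R(\square^1,X)\to X\times X$, pointed at $x\sigma_1$. A $k$-cube of $\Omega(X,x)$ is thus a $(k+1)$-cube of $X$ whose $\partial_{1,0}$- and $\partial_{1,1}$-faces are degenerate at $x$. $\Omega^0(X,x)=(X,x)$, $\Omega^n(X,x)=\Omega(\Omega^{n-1}(X,x))$; iterating, a $k$-cube of $\Omega^n(X,x)$ is identified with an $(n+k)$-cube of $X$. $\pi_0(X)$ is the colimit of $X\colon\square^{op}\to\mathsf{Set}$ (for Kan $X$: the set of homotopy classes of $0$-cubes), and $\pi_n(X,x)=\pi_0(\Omega^n(X,x))$. Relative maps: for monomorphisms $A\hookrightarrow X$, $B\hookrightarrow Y$, a relative map $(X,A)\to(Y,B)$ is a cubical map $X\to Y$ that restricts to a map $A\to B$. A relative homotopy from $f$ to $g$ is a relative map $H\colon(X\otimes\square^1,A\otimes\square^1)\to(Y,B)$ restricting to $f$ and $g$ at the $\partial_{1,0}$- and $\partial_{1,1}$-ends of $\square^1$. A pointed cubical set $(X,x)$ is regarded as a relative one via $x\colon\square^0\hookrightarrow X$. *)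

theory Defs
  imports Main "HOL-Library.FuncSet"
begin

section \<open>The category of cubes\<close>

text \<open>
  The poset \<open>[1]\<^sup>n\<close> is the set of Boolean lists of length \<open>n\<close>, with \<open>False\<close> for 0 and \<open>True\<close> for 1.
  Morphisms are extensional functions (\<open>undefined\<close> off their domain), so that equality in HOL
  is equality of maps of posets. Coordinates are numbered from 1.
\<close>

definition vert :: "nat \<Rightarrow> bool list set" where
  "vert n = {v. length v = n}"

definition idm :: "nat \<Rightarrow> bool list \<Rightarrow> bool list" where
  "idm n = (\<lambda>v\<in>vert n. v)"

definition face :: "nat \<Rightarrow> nat \<Rightarrow> bool \<Rightarrow> bool list \<Rightarrow> bool list" where
  "face n i \<epsilon> = (\<lambda>v\<in>vert (n - 1). take (i - 1) v @ [\<epsilon>] @ drop (i - 1) v)"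

definition degen :: "nat \<Rightarrow> nat \<Rightarrow> bool list \<Rightarrow> bool list" where
  "degen n i = (\<lambda>v\<in>vert n. take (i - 1) v @ drop i v)"

definition conn :: "nat \<Rightarrow> nat \<Rightarrow> bool \<Rightarrow> bool list \<Rightarrow> bool list" where
  "conn n i \<epsilon> = (\<lambda>v\<in>vert n. take (i - 1) v
      @ [if \<epsilon> then v ! (i - 1) \<and> v ! i else v ! (i - 1) \<or> v ! i] @ drop (i + 1) v)"

inductive box_mor :: "nat \<Rightarrow> nat \<Rightarrow> (bool list \<Rightarrow> bool list) \<Rightarrow> bool" where
  box_id: "box_mor n n (idm n)"
| box_face: "i \<in> {1..n} \<Longrightarrow> box_mor (n - 1) n (face n i \<epsilon>)"
| box_degen: "i \<in> {1..n} \<Longrightarrow> box_mor n (n - 1) (degen n i)"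
| box_conn: "i \<in> {1..n - 1} \<Longrightarrow> box_mor n (n - 1) (conn n i \<epsilon>)"
| box_comp: "box_mor l m \<phi> \<Longrightarrow> box_mor m n \<psi> \<Longrightarrow> box_mor l n (compose (vert l) \<psi> \<phi>)"

definition box_hom :: "nat \<Rightarrow> nat \<Rightarrow> (bool list \<Rightarrow> bool list) set" where
  "box_hom m n = {\<phi>. box_mor m n \<phi>}"

text \<open>The monoidal product \<open>\<phi> \<otimes> \<psi>\<close> of \<open>\<phi> : [1]\<^sup>m \<rightarrow> [1]\<^sup>m'\<close> and \<open>\<psi> : [1]\<^sup>n \<rightarrow> [1]\<^sup>n'\<close>;
  only the sizes of the domains are needed.\<close>

definition box_tensor ::
  "nat \<Rightarrow> nat \<Rightarrow> (bool list \<Rightarrow> bool list) \<Rightarrow> (bool list \<Rightarrow> bool list) \<Rightarrow> bool list \<Rightarrow> bool list" where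
  "box_tensor m n \<phi> \<psi> = (\<lambda>v\<in>vert (m + n). \<phi> (take m v) @ \<psi> (drop m v))"


section \<open>Cubical sets\<close>

text \<open>For \<open>\<phi> : [1]\<^sup>m \<rightarrow> [1]\<^sup>n\<close> and an \<open>n\<close>-cube \<open>x\<close>, the \<open>m\<close>-cube \<open>x\<phi>\<close> is \<open>act X m n \<phi> x\<close>.\<close>

record 'a cset =
  cells :: "nat \<Rightarrow> 'a set"
  act :: "nat \<Rightarrow> nat \<Rightarrow> (bool list \<Rightarrow> bool list) \<Rightarrow> 'a \<Rightarrow> 'a"

definition cubical_set :: "'a cset \<Rightarrow> bool" where
  "cubical_set X \<longleftrightarrow>
     (\<forall>m n. \<forall>\<phi>\<in>box_hom m n. \<forall>x\<in>cells X n. act X m n \<phi> x \<in> cells X m) \<and>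
     (\<forall>n. \<forall>x\<in>cells X n. act X n n (idm n) x = x) \<and>
     (\<forall>l m n. \<forall>\<phi>\<in>box_hom l m. \<forall>\<psi>\<in>box_hom m n. \<forall>x\<in>cells X n.
        act X l n (compose (vert l) \<psi> \<phi>) x = act X l m \<phi> (act X m n \<psi> x))"

text \<open>Cubical maps are extensional in each dimension, so that equality in HOL is equality of maps.\<close>

definition cmaps :: "'a cset \<Rightarrow> 'b cset \<Rightarrow> (nat \<Rightarrow> 'a \<Rightarrow> 'b) set" where
  "cmaps X Y = {f. (\<forall>n. f n \<in> cells X n \<rightarrow>\<^sub>E cells Y n) \<and>
     (\<forall>m n. \<forall>\<phi>\<in>box_hom m n. \<forall>x\<in>cells X n. f m (act X m n \<phi> x) = act Y m n \<phi> (f n x))}"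

definition cmap_comp ::
  "'a cset \<Rightarrow> (nat \<Rightarrow> 'b \<Rightarrow> 'c) \<Rightarrow> (nat \<Rightarrow> 'a \<Rightarrow> 'b) \<Rightarrow> nat \<Rightarrow> 'a \<Rightarrow> 'c" where
  "cmap_comp X g f = (\<lambda>k. compose (cells X k) (g k) (f k))"

definition cube :: "nat \<Rightarrow> (bool list \<Rightarrow> bool list) cset" where
  "cube n = \<lparr>cells = (\<lambda>k. box_hom k n), act = (\<lambda>j k \<phi> c. compose (vert j) c \<phi>)\<rparr>"

text \<open>The image of \<open>\<partial>\<^sub>i\<^sub>,\<^sub>\<epsilon> : \<box>\<^sup>n\<^sup>-\<^sup>1 \<rightarrow> \<box>\<^sup>n\<close> in dimension \<open>k\<close>.\<close>

definition face_image :: "nat \<Rightarrow> nat \<Rightarrow> bool \<Rightarrow> nat \<Rightarrow> (bool list \<Rightarrow> bool list) set" where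
  "face_image n i \<epsilon> k = (\<lambda>c. compose (vert k) (face n i \<epsilon>) c) ` box_hom k (n - 1)"

definition boundary :: "nat \<Rightarrow> (bool list \<Rightarrow> bool list) cset" where
  "boundary n = (cube n)\<lparr>cells := \<lambda>k. \<Union>i\<in>{1..n}. \<Union>\<epsilon>. face_image n i \<epsilon> k\<rparr>"

definition open_box :: "nat \<Rightarrow> nat \<Rightarrow> bool \<Rightarrow> (bool list \<Rightarrow> bool list) cset" where
  "open_box n i \<epsilon> =
     (cube n)\<lparr>cells := \<lambda>k. \<Union>(j, \<eta>)\<in>{1..n} \<times> UNIV - {(i, \<epsilon>)}. face_image n j \<eta> k\<rparr>"

definition Kan_complex :: "'a cset \<Rightarrow> bool" where
  "Kan_complex X \<longleftrightarrow> cubical_set X \<and>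
     (\<forall>n\<ge>1. \<forall>i\<in>{1..n}. \<forall>\<epsilon>. \<forall>f\<in>cmaps (open_box n i \<epsilon>) X.
        \<exists>g\<in>cmaps (cube n) X. \<forall>k. \<forall>c\<in>cells (open_box n i \<epsilon>) k. g k c = f k c)"


section \<open>The geometric product\<close>

definition gen_equiv :: "('a \<times> 'a) set \<Rightarrow> ('a \<times> 'a) set" where
  "gen_equiv R = (R \<union> R\<inverse>)\<^sup>*"

text \<open>
  The left Kan extension is the coend formula
  \<open>(X \<otimes> Y)\<^sub>k = \<integral>\<^sup>m\<^sup>,\<^sup>n \<box>([1]\<^sup>k, [1]\<^sup>m\<^sup>+\<^sup>n) \<times> X\<^sub>m \<times> Y\<^sub>n\<close>: tuples \<open>(m, n, \<phi>, x, y)\<close> modulo the equivalence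
  relation generated by \<open>((\<alpha> \<otimes> \<beta>)\<phi>, x, y) \<sim> (\<phi>, x\<alpha>, y\<beta>)\<close>.
\<close>

type_synonym ('a, 'b) pretensor = "nat \<times> nat \<times> (bool list \<Rightarrow> bool list) \<times> 'a \<times> 'b"

definition pretensor :: "'a cset \<Rightarrow> 'b cset \<Rightarrow> nat \<Rightarrow> ('a, 'b) pretensor set" where
  "pretensor X Y k = {(m, n, \<phi>, x, y). \<phi> \<in> box_hom k (m + n) \<and> x \<in> cells X m \<and> y \<in> cells Y n}"

definition tensor_rel ::
  "'a cset \<Rightarrow> 'b cset \<Rightarrow> nat \<Rightarrow> (('a, 'b) pretensor \<times> ('a, 'b) pretensor) set" where
  "tensor_rel X Y k =
     {((m', n', compose (vert k) (box_tensor m n \<alpha> \<beta>) \<phi>, x, y),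
       (m, n, \<phi>, act X m m' \<alpha> x, act Y n n' \<beta> y)) | m m' n n' \<alpha> \<beta> \<phi> x y.
        \<alpha> \<in> box_hom m m' \<and> \<beta> \<in> box_hom n n' \<and> \<phi> \<in> box_hom k (m + n) \<and>
        x \<in> cells X m' \<and> y \<in> cells Y n'}"

definition tensor_class ::
  "'a cset \<Rightarrow> 'b cset \<Rightarrow> nat \<Rightarrow> ('a, 'b) pretensor \<Rightarrow> ('a, 'b) pretensor set" where
  "tensor_class X Y k t = gen_equiv (tensor_rel X Y k) `` {t}"

definition geom_prod :: "'a cset \<Rightarrow> 'b cset \<Rightarrow> ('a, 'b) pretensor set cset" where
  "geom_prod X Y =
     \<lparr>cells = (\<lambda>k. pretensor X Y k // gen_equiv (tensor_rel X Y k)),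
      act = (\<lambda>j k \<psi> C. \<Union>(m, n, \<phi>, x, y)\<in>C.
               tensor_class X Y j (m, n, compose (vert j) \<phi> \<psi>, x, y))\<rparr>"

text \<open>For a subcomplex \<open>A\<close> of \<open>X\<close>, the subcomplex of \<open>X \<otimes> Y\<close> which is the image of \<open>A \<otimes> Y\<close>.\<close>

definition geom_prod_sub :: "'a cset \<Rightarrow> 'a cset \<Rightarrow> 'b cset \<Rightarrow> ('a, 'b) pretensor set cset" where
  "geom_prod_sub X A Y =
     (geom_prod X Y)\<lparr>cells := \<lambda>k. tensor_class X Y k ` pretensor A Y k\<rparr>"

text \<open>The end inclusion \<open>X \<cong> X \<otimes> \<box>\<^sup>0 \<rightarrow> X \<otimes> \<box>\<^sup>1\<close> induced by \<open>\<partial>\<^sub>1\<^sub>,\<^sub>\<epsilon>\<close>.\<close>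

definition end_incl ::
  "'a cset \<Rightarrow> bool \<Rightarrow> nat \<Rightarrow> 'a \<Rightarrow> ('a, bool list \<Rightarrow> bool list) pretensor set" where
  "end_incl X \<epsilon> k x = tensor_class X (cube 1) k (k, 0, idm k, x, face 1 1 \<epsilon>)"


section \<open>Relative maps and relative homotopy classes\<close>

text \<open>A monomorphism \<open>A \<rightarrow> X\<close> is represented by its image, a cubical set with the operators of \<open>X\<close>
  and \<open>cells A k \<subseteq> cells X k\<close>.\<close>

definition rel_maps :: "'a cset \<Rightarrow> 'a cset \<Rightarrow> 'b cset \<Rightarrow> 'b cset \<Rightarrow> (nat \<Rightarrow> 'a \<Rightarrow> 'b) set" where
  "rel_maps X A Y B = {f \<in> cmaps X Y. \<forall>k. f k ` cells A k \<subseteq> cells B k}"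

definition rel_homotopies ::
  "'a cset \<Rightarrow> 'a cset \<Rightarrow> 'b cset \<Rightarrow> 'b cset \<Rightarrow> (nat \<Rightarrow> 'a \<Rightarrow> 'b) \<Rightarrow> (nat \<Rightarrow> 'a \<Rightarrow> 'b)
    \<Rightarrow> (nat \<Rightarrow> ('a, bool list \<Rightarrow> bool list) pretensor set \<Rightarrow> 'b) set" where
  "rel_homotopies X A Y B f g =
     {H \<in> rel_maps (geom_prod X (cube 1)) (geom_prod_sub X A (cube 1)) Y B.
        \<forall>k. \<forall>x\<in>cells X k. H k (end_incl X False k x) = f k x \<and> H k (end_incl X True k x) = g k x}"

definition rel_htpy ::
  "'a cset \<Rightarrow> 'a cset \<Rightarrow> 'b cset \<Rightarrow> 'b cset \<Rightarrow> ((nat \<Rightarrow> 'a \<Rightarrow> 'b) \<times> (nat \<Rightarrow> 'a \<Rightarrow> 'b)) set" where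
  "rel_htpy X A Y B = {(f, g). f \<in> rel_maps X A Y B \<and> g \<in> rel_maps X A Y B \<and>
                                rel_homotopies X A Y B f g \<noteq> {}}"

definition rel_classes ::
  "'a cset \<Rightarrow> 'a cset \<Rightarrow> 'b cset \<Rightarrow> 'b cset \<Rightarrow> (nat \<Rightarrow> 'a \<Rightarrow> 'b) set set" where
  "rel_classes X A Y B = rel_maps X A Y B // rel_htpy X A Y B"


section \<open>Pointed cubical sets, loop spaces and homotopy groups\<close>

type_synonym 'a pcset = "'a cset \<times> 'a"

definition pointed :: "'a pcset \<Rightarrow> bool" where
  "pointed = (\<lambda>(X, x). cubical_set X \<and> x \<in> cells X 0)"

definition pointed_maps :: "'a pcset \<Rightarrow> 'b pcset \<Rightarrow> (nat \<Rightarrow> 'a \<Rightarrow> 'b) set" where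
  "pointed_maps = (\<lambda>(X, x) (Y, y). {p \<in> cmaps X Y. p 0 x = y})"

definition const_cell :: "'a pcset \<Rightarrow> nat \<Rightarrow> 'a" where
  "const_cell = (\<lambda>(X, x) k. act X k 0 (\<lambda>v\<in>vert k. []) x)"

text \<open>The image of \<open>x : \<box>\<^sup>0 \<rightarrow> X\<close>.\<close>

definition point_sub :: "'a pcset \<Rightarrow> 'a cset" where
  "point_sub P = (fst P)\<lparr>cells := \<lambda>k. {const_cell P k}\<rparr>"

text \<open>By the Yoneda lemma \<open>hom\<^sub>R(\<box>\<^sup>1, X)\<^sub>k = Hom(\<box>\<^sup>1 \<otimes> \<box>\<^sup>k, X) = X\<^sub>1\<^sub>+\<^sub>k\<close>, with \<open>\<phi>\<close> acting by
  \<open>(id \<otimes> \<phi>)\<^sup>*\<close>; the map to \<open>X\<close> induced by \<open>\<partial>\<^sub>1\<^sub>,\<^sub>\<epsilon>\<close> is \<open>(\<partial>\<^sub>1\<^sub>,\<^sub>\<epsilon> \<otimes> id)\<^sup>*\<close>.\<close>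

definition path_object :: "'a cset \<Rightarrow> 'a cset" where
  "path_object X =
     \<lparr>cells = (\<lambda>k. cells X (1 + k)),
      act = (\<lambda>j k \<phi>. act X (1 + j) (1 + k) (box_tensor 1 j (idm 1) \<phi>))\<rparr>"

definition path_end :: "'a cset \<Rightarrow> bool \<Rightarrow> nat \<Rightarrow> 'a \<Rightarrow> 'a" where
  "path_end X \<epsilon> k = act X k (1 + k) (box_tensor 0 k (face 1 1 \<epsilon>) (idm k))"

definition loop :: "'a pcset \<Rightarrow> 'a pcset" where
  "loop = (\<lambda>(X, x).
     ((path_object X)\<lparr>cells := \<lambda>k. {c \<in> cells (path_object X) k.
         path_end X False k c = const_cell (X, x) k \<and> path_end X True k c = const_cell (X, x) k}\<rparr>,
      act X 1 0 (degen 1 1) x))"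

definition loops :: "nat \<Rightarrow> 'a pcset \<Rightarrow> 'a pcset" where
  "loops n = loop ^^ n"

definition loop_map :: "'a pcset \<Rightarrow> (nat \<Rightarrow> 'a \<Rightarrow> 'b) \<Rightarrow> nat \<Rightarrow> 'a \<Rightarrow> 'b" where
  "loop_map P p = (\<lambda>k. restrict (p (1 + k)) (cells (fst (loop P)) k))"

primrec loops_map :: "nat \<Rightarrow> 'a pcset \<Rightarrow> (nat \<Rightarrow> 'a \<Rightarrow> 'b) \<Rightarrow> nat \<Rightarrow> 'a \<Rightarrow> 'b" where
  "loops_map 0 P p = p"
| "loops_map (Suc n) P p = loop_map (loops n P) (loops_map n P p)"

text \<open>\<open>\<pi>\<^sub>0(X)\<close> is the colimit of \<open>X\<close> as a functor: the cubes \<open>(n, x)\<close> of all dimensions modulo the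
  equivalence relation generated by \<open>x\<phi> \<sim> x\<close>.\<close>

definition pi0_rel :: "'a cset \<Rightarrow> ((nat \<times> 'a) \<times> (nat \<times> 'a)) set" where
  "pi0_rel X = {((m, act X m n \<phi> x), (n, x)) | m n \<phi> x. \<phi> \<in> box_hom m n \<and> x \<in> cells X n}"

definition pi0_class :: "'a cset \<Rightarrow> nat \<times> 'a \<Rightarrow> (nat \<times> 'a) set" where
  "pi0_class X t = gen_equiv (pi0_rel X) `` {t}"

definition pi0 :: "'a cset \<Rightarrow> (nat \<times> 'a) set set" where
  "pi0 X = (SIGMA n:UNIV. cells X n) // gen_equiv (pi0_rel X)"

definition pi0_map :: "'b cset \<Rightarrow> (nat \<Rightarrow> 'a \<Rightarrow> 'b) \<Rightarrow> (nat \<times> 'a) set \<Rightarrow> (nat \<times> 'b) set" where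
  "pi0_map Y g C = (\<Union>(k, x)\<in>C. pi0_class Y (k, g k x))"

definition pi_n :: "nat \<Rightarrow> 'a pcset \<Rightarrow> (nat \<times> 'a) set set" where
  "pi_n n P = pi0 (fst (loops n P))"

definition pi_n_map ::
  "nat \<Rightarrow> 'a pcset \<Rightarrow> 'b pcset \<Rightarrow> (nat \<Rightarrow> 'a \<Rightarrow> 'b) \<Rightarrow> (nat \<times> 'a) set \<Rightarrow> (nat \<times> 'b) set" where
  "pi_n_map n P Q p = pi0_map (fst (loops n Q)) (loops_map n P p)"


section \<open>The comparison\<close>

definition sphere_maps ::
  "nat \<Rightarrow> 'a pcset \<Rightarrow> (nat \<Rightarrow> (bool list \<Rightarrow> bool list) \<Rightarrow> 'a) set" where
  "sphere_maps n P = rel_maps (cube n) (boundary n) (fst P) (point_sub P)"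

definition sphere_htpy ::
  "nat \<Rightarrow> 'a pcset \<Rightarrow> ((nat \<Rightarrow> (bool list \<Rightarrow> bool list) \<Rightarrow> 'a)
                       \<times> (nat \<Rightarrow> (bool list \<Rightarrow> bool list) \<Rightarrow> 'a)) set" where
  "sphere_htpy n P = rel_htpy (cube n) (boundary n) (fst P) (point_sub P)"

definition sphere_classes ::
  "nat \<Rightarrow> 'a pcset \<Rightarrow> (nat \<Rightarrow> (bool list \<Rightarrow> bool list) \<Rightarrow> 'a) set set" where
  "sphere_classes n P = rel_classes (cube n) (boundary n) (fst P) (point_sub P)"

definition sphere_classes_map ::
  "nat \<Rightarrow> 'b pcset \<Rightarrow> (nat \<Rightarrow> 'a \<Rightarrow> 'b) \<Rightarrow> (nat \<Rightarrow> (bool list \<Rightarrow> bool list) \<Rightarrow> 'a) set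
    \<Rightarrow> (nat \<Rightarrow> (bool list \<Rightarrow> bool list) \<Rightarrow> 'b) set" where
  "sphere_classes_map n Q p F = (\<Union>f\<in>F. sphere_htpy n Q `` {cmap_comp (cube n) p f})"

text \<open>The \<open>n\<close>-cube of \<open>X\<close> represented by \<open>f : \<box>\<^sup>n \<rightarrow> X\<close>. A \<open>k\<close>-cube of \<open>\<Omega>\<^sup>n(X, x)\<close> literally is an
  \<open>(n + k)\<close>-cube of \<open>X\<close>, so this is also the corresponding 0-cube of \<open>\<Omega>\<^sup>n(X, x)\<close>.\<close>

definition top_cell :: "nat \<Rightarrow> (nat \<Rightarrow> (bool list \<Rightarrow> bool list) \<Rightarrow> 'a) \<Rightarrow> 'a" where
  "top_cell n f = f n (idm n)"

definition comparison ::
  "nat \<Rightarrow> 'a pcset \<Rightarrow> (nat \<Rightarrow> (bool list \<Rightarrow> bool list) \<Rightarrow> 'a) set \<Rightarrow> (nat \<times> 'a) set" where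
  "comparison n P F = (\<Union>f\<in>F. pi0_class (fst (loops n P)) (0, top_cell n f))"

end

theory Submission
  imports Defs
begin

text \<open>
  A map \<open>\<box>\<^sup>n \<rightarrow> X\<close> sending the boundary to the base point is, by the Yoneda lemma, an \<open>n\<close>-cube
  with constant faces, that is, a 0-cube of \<open>L = \<Omega>\<^sup>n(X, x)\<close>. A relative homotopy of such maps is a
  map \<open>\<box>\<^sup>n\<^sup>+\<^sup>1 = \<box>\<^sup>n \<otimes> \<box>\<^sup>1 \<rightarrow> X\<close>, namely an \<open>(n + 1)\<close>-cube with constant faces in the first \<open>n\<close>
  directions, that is, an edge of \<open>L\<close>. So everything reduces to comparing the edge relation of \<open>L\<close>
  with the equivalence relation defining \<open>\<pi>\<^sub>0(L)\<close>. Filling a single \<open>(n + 2)\<close>-dimensional open box in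
  \<open>X\<close> shows that the edge relation is an equivalence relation. Any two vertices of a cube of \<open>L\<close> are
  joined by a path of edges, so sending a cube to its initial vertex identifies \<open>\<pi>\<^sub>0(L)\<close> with the
  quotient of the 0-cubes of \<open>L\<close> by the edge relation.
\<close>

section \<open>Morphisms of the box category\<close>

text \<open>The order of coordinates is what lets homotopies and edges match. Loops put the interval
  on the left, so in a cube of L the n loop directions come first and the free directions last;
  homotopies put the interval on the right, so their parameter is also the last coordinate. The two
  notions therefore give the same (n + 1)-cube of X without a permutation of coordinates, which the
  box category does not contain.

  The box is filled in X itself, with constant faces in the loop directions; this spares a proof
  that L is again Kan. The price is that the Kan condition speaks of maps out of a subcomplex, so
  compatible faces must first be glued to such a map.

  The product of the n-cube and the interval is never replaced by the (n + 1)-cube through an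
  isomorphism. A homotopy is evaluated at the class of the pair of identities, and conversely an (n
  + 1)-cube is evaluated on the tuples of the coend.\<close>

lemma in_vert [simp]: "v \<in> vert n \<longleftrightarrow> length v = n"
  by (simp add: vert_def)

lemma box_hom_funcset: "\<phi> \<in> box_hom m n \<Longrightarrow> \<phi> \<in> vert m \<rightarrow>\<^sub>E vert n"
proof -
  assume "\<phi> \<in> box_hom m n"
  then have "box_mor m n \<phi>" by (simp add: box_hom_def)
  then show ?thesis
  proof induction
    case (box_comp l m \<phi> n \<psi>)
    then show ?case by (auto simp: PiE_def Pi_def) (simp_all add: compose_def)
  qed (auto simp: idm_def face_def degen_def conn_def)
qed

lemma box_hom_length: "\<phi> \<in> box_hom m n \<Longrightarrow> length v = m \<Longrightarrow> length (\<phi> v) = n"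
  using box_hom_funcset[of \<phi> m n] by (auto)

lemma box_hom_extensional [simp]: "\<phi> \<in> box_hom m n \<Longrightarrow> \<phi> \<in> extensional (vert m)"
  using box_hom_funcset[of \<phi> m n] by (auto simp: PiE_def)

lemma idm_box_hom [simp]: "idm n \<in> box_hom n n"
  by (simp add: box_hom_def box_id)

lemma face_box_hom: "i \<in> {1..n} \<Longrightarrow> face n i \<epsilon> \<in> box_hom (n - 1) n"
  unfolding box_hom_def using box_face by blast

lemma face_Suc_box_hom: "i \<in> {1..Suc n} \<Longrightarrow> face (Suc n) i \<epsilon> \<in> box_hom n (Suc n)"
  using face_box_hom[of i "Suc n"] by simp

lemma degen_box_hom: "i \<in> {1..n} \<Longrightarrow> degen n i \<in> box_hom n (n - 1)"
  unfolding box_hom_def using box_degen by blast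

lemma degen_Suc_box_hom: "i \<in> {1..Suc n} \<Longrightarrow> degen (Suc n) i \<in> box_hom (Suc n) n"
  using degen_box_hom[of i "Suc n"] by simp

lemma compose_box_hom:
  "\<phi> \<in> box_hom l m \<Longrightarrow> \<psi> \<in> box_hom m n \<Longrightarrow> compose (vert l) \<psi> \<phi> \<in> box_hom l n"
  unfolding box_hom_def using box_comp by blast

lemma vert_ext:
  assumes "f \<in> extensional (vert m)" "g \<in> extensional (vert m)"
    and "\<And>v. length v = m \<Longrightarrow> f v = g v"
  shows "f = g"
  using assms by (intro extensionalityI[of f "vert m" g]) (auto)

lemma compose_idm_left: "\<phi> \<in> box_hom m n \<Longrightarrow> compose (vert m) (idm n) \<phi> = \<phi>"
  by (rule vert_ext[of _ m])
    (auto simp: compose_def idm_def box_hom_extensional box_hom_length)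

lemma compose_idm_right: "\<phi> \<in> box_hom m n \<Longrightarrow> compose (vert m) \<phi> (idm m) = \<phi>"
  by (rule vert_ext[of _ m])
    (auto simp: compose_def idm_def box_hom_extensional)

lemma compose_assoc_box:
  "\<phi> \<in> box_hom k l \<Longrightarrow>
    compose (vert k) (compose (vert l) \<chi> \<psi>) \<phi> = compose (vert k) \<chi> (compose (vert k) \<psi> \<phi>)"
  by (rule vert_ext[of _ k]) (auto simp: compose_def box_hom_length)

section \<open>The monoidal product of box morphisms\<close>

lemma box_tensor_extensional [simp]: "box_tensor m n \<phi> \<psi> \<in> extensional (vert (m + n))"
  by (simp add: box_tensor_def)

lemma box_tensor_compose:
  assumes "\<phi> \<in> box_hom m m'" "\<psi> \<in> box_hom n n'"
  shows "compose (vert (m + n)) (box_tensor m' n' \<phi>' \<psi>') (box_tensor m n \<phi> \<psi>)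
    = box_tensor m n (compose (vert m) \<phi>' \<phi>) (compose (vert n) \<psi>' \<psi>)"
  by (rule vert_ext[of _ "m + n"])
    (auto simp: compose_def box_tensor_def box_hom_length[OF assms(1)] box_hom_length[OF assms(2)])

lemma box_tensor_idm: "box_tensor m n (idm m) (idm n) = idm (m + n)"
  by (rule vert_ext[of _ "m + n"]) (auto simp: box_tensor_def idm_def)

lemma box_tensor_face_left:
  assumes "i \<in> {1..n}"
  shows "box_tensor (n - 1) k (face n i \<epsilon>) (idm k) = face (n + k) i \<epsilon>"
proof (rule vert_ext[of _ "n - 1 + k"])
  show "face (n + k) i \<epsilon> \<in> extensional (vert (n - 1 + k))"
    using assms by (auto simp: face_def)
  fix v :: "bool list" assume v: "length v = n - 1 + k"
  define a b where "a = take (n - 1) v" and "b = drop (n - 1) v"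
  then have "v = a @ b" "length a = n - 1" "length b = k" using v by auto
  then show "box_tensor (n - 1) k (face n i \<epsilon>) (idm k) v = face (n + k) i \<epsilon> v"
    using assms by (auto simp: box_tensor_def face_def idm_def)
qed simp

lemma box_tensor_face_right:
  assumes "i \<in> {1..n}"
  shows "box_tensor k (n - 1) (idm k) (face n i \<epsilon>) = face (k + n) (k + i) \<epsilon>"
proof (rule vert_ext[of _ "k + (n - 1)"])
  show "face (k + n) (k + i) \<epsilon> \<in> extensional (vert (k + (n - 1)))"
    using assms by (auto simp: face_def)
  fix v :: "bool list" assume v: "length v = k + (n - 1)"
  obtain j where j: "i = Suc j" using assms by (cases i) auto
  have "take (k + j) v = take k v @ take j (drop k v)" by (simp add: take_add)
  then show "box_tensor k (n - 1) (idm k) (face n i \<epsilon>) v = face (k + n) (k + i) \<epsilon> v"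
    using v assms j by (auto simp: box_tensor_def face_def idm_def add.commute)
qed simp

text \<open>Morphisms are given by generators, so closure under the product goes generator by
  generator: with \<open>idm k\<close> on the left, each face, degeneracy and connection keeps its
  kind and has its index raised by k.\<close>

lemma box_tensor_idm_left:
  assumes "\<phi> \<in> box_hom m n" shows "box_tensor k m (idm k) \<phi> \<in> box_hom (k + m) (k + n)"
proof -
  have "box_mor m n \<phi>" using assms by (simp add: box_hom_def)
  then show ?thesis
  proof induction
    case (box_id n) then show ?case by (simp add: box_tensor_idm)
  next
    case (box_face i n \<epsilon>)
    then show ?case using box_tensor_face_right[of i n k] face_box_hom[of "k + i" "k + n" \<epsilon>] by auto
  next
    case (box_degen i n)
    have "box_tensor k n (idm k) (degen n i) = degen (k + n) (k + i)"
    proof (rule vert_ext[of _ "k + n"])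
      fix v :: "bool list" assume v: "length v = k + n"
      obtain j where j: "i = Suc j" using box_degen by (cases i) auto
      have "take (k + j) v = take k v @ take j (drop k v)" by (simp add: take_add)
      then show "box_tensor k n (idm k) (degen n i) v = degen (k + n) (k + i) v"
        using v j by (auto simp: box_tensor_def degen_def idm_def add.commute)
    qed (auto simp: degen_def)
    then show ?case using degen_box_hom[of "k + i" "k + n"] box_degen by auto
  next
    case (box_conn i n \<epsilon>)
    have "box_tensor k n (idm k) (conn n i \<epsilon>) = conn (k + n) (k + i) \<epsilon>"
    proof (rule vert_ext[of _ "k + n"])
      fix v :: "bool list" assume v: "length v = k + n"
      obtain j where j: "i = Suc j" using box_conn by (cases i) auto
      have "take (k + j) v = take k v @ take j (drop k v)" by (simp add: take_add)
      then show "box_tensor k n (idm k) (conn n i \<epsilon>) v = conn (k + n) (k + i) \<epsilon> v"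
        using v j box_conn by (auto simp: box_tensor_def conn_def idm_def add.commute)
    qed (auto simp: conn_def)
    moreover have "box_mor (k + n) (k + n - 1) (conn (k + n) (k + i) \<epsilon>)"
      using box_conn by (intro box_mor.box_conn) auto
    ultimately show ?case using box_conn by (auto simp: box_hom_def)
  next
    case (box_comp l m \<phi> n \<psi>)
    then have "compose (vert (k + l)) (box_tensor k m (idm k) \<psi>) (box_tensor k l (idm k) \<phi>)
      = box_tensor k l (idm k) (compose (vert l) \<psi> \<phi>)"
      using box_tensor_compose[of "idm k" k k \<phi> l m "idm k" \<psi>]
      by (simp add: box_hom_def compose_idm_left box_id)
    then show ?case using box_comp compose_box_hom by metis
  qed
qed

text \<open>With the identity on the right the index stays and only the dimension grows.\<close>

lemma box_tensor_idm_right: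
  assumes "\<phi> \<in> box_hom m n" shows "box_tensor m k \<phi> (idm k) \<in> box_hom (m + k) (n + k)"
proof -
  have "box_mor m n \<phi>" using assms by (simp add: box_hom_def)
  then show ?thesis
  proof induction
    case (box_id n) then show ?case by (simp add: box_tensor_idm)
  next
    case (box_face i n \<epsilon>)
    then show ?case using box_tensor_face_left[of i n k] face_box_hom[of "i" "n + k" \<epsilon>] by auto
  next
    case (box_degen i n)
    have "box_tensor n k (degen n i) (idm k) = degen (n + k) i"
    proof (rule vert_ext[of _ "n + k"])
      fix v :: "bool list" assume v: "length v = n + k"
      define a b where "a = take n v" and "b = drop n v"
      then have "v = a @ b" "length a = n" "length b = k" using v by auto
      then show "box_tensor n k (degen n i) (idm k) v = degen (n + k) i v"
        using box_degen by (auto simp: box_tensor_def degen_def idm_def)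
    qed (auto simp: degen_def)
    then show ?case using degen_box_hom[of "i" "n + k"] box_degen by auto
  next
    case (box_conn i n \<epsilon>)
    then have "1 \<le> i" "i < n" by auto
    have "box_tensor n k (conn n i \<epsilon>) (idm k) = conn (n + k) i \<epsilon>"
    proof (rule vert_ext[of _ "n + k"])
      fix v :: "bool list" assume v: "length v = n + k"
      define a b where "a = take n v" and "b = drop n v"
      then have "v = a @ b" "length a = n" "length b = k" using v by auto
      then show "box_tensor n k (conn n i \<epsilon>) (idm k) v = conn (n + k) i \<epsilon> v"
        using \<open>1 \<le> i\<close> \<open>i < n\<close> by (auto simp: box_tensor_def conn_def idm_def nth_append)
    qed (auto simp: conn_def)
    moreover have "box_mor (n + k) (n + k - 1) (conn (n + k) i \<epsilon>)"
      using box_conn by (intro box_mor.box_conn) auto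
    ultimately show ?case using box_conn by (auto simp: box_hom_def)
  next
    case (box_comp l m \<phi> n \<psi>)
    then have "compose (vert (l + k)) (box_tensor m k \<psi> (idm k)) (box_tensor l k \<phi> (idm k))
      = box_tensor l k (compose (vert l) \<psi> \<phi>) (idm k)"
      using box_tensor_compose[of \<phi> l m "idm k" k k \<psi> "idm k"]
      by (simp add: box_hom_def compose_idm_left box_id)
    then show ?case using box_comp compose_box_hom by metis
  qed
qed

text \<open>By interchange the product applies \<psi> first and \<phi> afterwards, each beside an
  identity, so the two one-sided cases suffice.\<close>

lemma box_tensor_box_hom:
  assumes "\<phi> \<in> box_hom m m'" "\<psi> \<in> box_hom n n'"
  shows "box_tensor m n \<phi> \<psi> \<in> box_hom (m + n) (m' + n')"
proof -
  have "compose (vert (m + n)) (box_tensor m n' \<phi> (idm n')) (box_tensor m n (idm m) \<psi>)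
      = box_tensor m n \<phi> \<psi>"
    using box_tensor_compose[of "idm m" m m \<psi> n n' \<phi> "idm n'"] assms
    by (simp add: compose_idm_left compose_idm_right)
  then show ?thesis
    using compose_box_hom[OF box_tensor_idm_left[OF assms(2), of m] box_tensor_idm_right[OF assms(1), of n']]
    by simp
qed

lemma box_tensor_0_left: "\<phi> \<in> box_hom m n \<Longrightarrow> box_tensor 0 m (idm 0) \<phi> = \<phi>"
  by (rule vert_ext[of _ m])
    (auto simp: box_hom_extensional box_tensor_def idm_def)

lemma box_tensor_assoc_idm:
  "box_tensor m (l + j) (idm m) (box_tensor l j (idm l) \<phi>) = box_tensor (m + l) j (idm (m + l)) \<phi>"
  by (rule vert_ext[of _ "m + l + j"])
    (auto simp: box_tensor_def idm_def take_add add.commute[of l m] add.assoc extensional_def)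

section \<open>Maps into and out of \<open>[1]^0\<close>, and the exchange of two faces\<close>

definition const0 :: "nat \<Rightarrow> bool list \<Rightarrow> bool list" where
  "const0 k = (\<lambda>v\<in>vert k. [])"

lemma const0_box_hom: "const0 k \<in> box_hom k 0"
proof (induction k)
  case 0
  have "const0 0 = idm 0" by (rule vert_ext[of _ 0]) (auto simp: const0_def idm_def)
  then show ?case by simp
next
  case (Suc k)
  have "const0 (Suc k) = compose (vert (Suc k)) (const0 k) (degen (Suc k) 1)"
    by (rule vert_ext[of _ "Suc k"]) (auto simp: const0_def compose_def degen_def)
  then show ?case using compose_box_hom[OF degen_Suc_box_hom[of 1 k] Suc] by simp
qed

text \<open>\<open>[1]^0\<close> is terminal. Uniqueness of maps into it replaces most computations
  with degenerate cubes.\<close>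

lemma box_hom_0_unique: "\<phi> \<in> box_hom k 0 \<Longrightarrow> \<phi> = const0 k"
  by (rule vert_ext[of _ k])
    (auto simp: box_hom_extensional const0_def dest: box_hom_length)

definition point :: "bool list \<Rightarrow> bool list \<Rightarrow> bool list" where
  "point v = (\<lambda>u\<in>vert 0. v)"

lemma point_box_hom: "point v \<in> box_hom 0 (length v)"
proof (induction v)
  case Nil
  have "point [] = idm 0" by (rule vert_ext[of _ 0]) (auto simp: point_def idm_def)
  then show ?case by simp
next
  case (Cons e v)
  have "point (e # v) = compose (vert 0) (face (Suc (length v)) 1 e) (point v)"
    by (rule vert_ext[of _ 0]) (auto simp: point_def compose_def face_def)
  then show ?case using compose_box_hom[OF Cons face_Suc_box_hom[of 1 "length v" e]] by simp
qed

lemma compose_point: "\<phi> \<in> box_hom m n \<Longrightarrow> compose (vert 0) \<phi> (point v) = point (\<phi> v)"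
  by (rule vert_ext[of _ 0]) (auto simp: point_def compose_def)

text \<open>A coordinate inserted at j' - 1 is pushed to j' by the later insertion at j < j'.
  Cutting the list at both insertion points turns the two sides into the same concatenation. The
  identity yields the faces of the missing side of a filled box.\<close>

lemma compose_face_face:
  assumes "1 \<le> j" "j < j'" "j' \<le> Suc (Suc n)"
  shows "compose (vert n) (face (Suc (Suc n)) j \<eta>) (face (Suc n) (j' - 1) \<eta>')
    = compose (vert n) (face (Suc (Suc n)) j' \<eta>') (face (Suc n) j \<eta>)"
proof (rule vert_ext[of _ n])
  fix v :: "bool list" assume v: "length v = n"
  obtain i where i: "j = Suc i" using assms by (cases j) auto
  obtain i' where i': "j' = Suc (Suc i')" using assms by (metis i lessE old.nat.exhaust not_less0 Suc_less_eq)
  have le: "i \<le> i'" "i' \<le> n" using assms i i' by auto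
  define a where "a = take i v"
  define b where "b = take (i' - i) (drop i v)"
  define c where "c = drop i' v"
  have "drop i v = b @ c" using le by (simp add: b_def c_def) (metis add.commute append_take_drop_id drop_drop le_add_diff_inverse)
  then have vv: "v = a @ b @ c" using append_take_drop_id[of i v] by (simp add: a_def)
  have la: "length a = i" "length b = i' - i" using le v by (auto simp: a_def b_def)
  show "compose (vert n) (face (Suc (Suc n)) j \<eta>) (face (Suc n) (j' - 1) \<eta>') v
    = compose (vert n) (face (Suc (Suc n)) j' \<eta>') (face (Suc n) j \<eta>) v"
    using v le la by (auto simp: compose_def face_def i i' vv Suc_diff_le)
qed auto


section \<open>Cubical sets and the Yoneda lemma\<close>

lemma act_cell: "cubical_set X \<Longrightarrow> \<phi> \<in> box_hom m n \<Longrightarrow> x \<in> cells X n \<Longrightarrow> act X m n \<phi> x \<in> cells X m"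
  by (simp add: cubical_set_def)

lemma act_idm: "cubical_set X \<Longrightarrow> x \<in> cells X n \<Longrightarrow> act X n n (idm n) x = x"
  by (simp add: cubical_set_def)

lemma act_act:
  "cubical_set X \<Longrightarrow> \<phi> \<in> box_hom l m \<Longrightarrow> \<psi> \<in> box_hom m n \<Longrightarrow> x \<in> cells X n \<Longrightarrow>
    act X l m \<phi> (act X m n \<psi> x) = act X l n (compose (vert l) \<psi> \<phi>) x"
  by (simp add: cubical_set_def)

lemma cmaps_cell: "f \<in> cmaps X Y \<Longrightarrow> x \<in> cells X n \<Longrightarrow> f n x \<in> cells Y n"
  by (auto simp: cmaps_def)

lemma cmaps_act:
  "f \<in> cmaps X Y \<Longrightarrow> \<phi> \<in> box_hom m n \<Longrightarrow> x \<in> cells X n \<Longrightarrow> f m (act X m n \<phi> x) = act Y m n \<phi> (f n x)"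
  by (auto simp: cmaps_def)

lemma cmaps_extensional: "f \<in> cmaps X Y \<Longrightarrow> f n \<in> extensional (cells X n)"
  by (auto simp: cmaps_def PiE_def)

lemma cmaps_ext:
  assumes "f \<in> cmaps X Y" "g \<in> cmaps X Z" "\<And>n x. x \<in> cells X n \<Longrightarrow> f n x = g n x"
  shows "f = g"
  using cmaps_extensional[OF assms(1)] cmaps_extensional[OF assms(2)] assms(3)
  by (intro ext) (metis extensional_arb)

lemma cells_cube [simp]: "cells (cube n) k = box_hom k n"
  by (simp add: cube_def)

lemma act_cube [simp]: "act (cube n) j k \<phi> c = compose (vert j) c \<phi>"
  by (simp add: cube_def)

text \<open>\<open>c\<close> is \<open>idm n\<close> acted on by \<open>c\<close>, so naturality
  leaves only the value at \<open>idm n\<close>.\<close>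

lemma cmaps_cube_apply:
  assumes "f \<in> cmaps (cube n) X" "c \<in> box_hom k n"
  shows "f k c = act X k n c (top_cell n f)"
  using cmaps_act[OF assms(1), of c k n "idm n"] assms
  by (simp add: compose_idm_left top_cell_def)

definition yoneda :: "'a cset \<Rightarrow> nat \<Rightarrow> 'a \<Rightarrow> nat \<Rightarrow> (bool list \<Rightarrow> bool list) \<Rightarrow> 'a" where
  "yoneda X n a = (\<lambda>k. \<lambda>c\<in>box_hom k n. act X k n c a)"

lemma yoneda_cmaps:
  assumes "cubical_set X" "a \<in> cells X n"
  shows "yoneda X n a \<in> cmaps (cube n) X"
  using assms by (auto simp: cmaps_def yoneda_def act_cell act_act compose_box_hom)

lemma top_cell_yoneda: "cubical_set X \<Longrightarrow> a \<in> cells X n \<Longrightarrow> top_cell n (yoneda X n a) = a"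
  by (simp add: top_cell_def yoneda_def act_idm)

lemma const_cell_conv: "const_cell (X, x) k = act X k 0 (const0 k) x"
  by (simp add: const_cell_def const0_def)

lemma const_cell_cell: "cubical_set X \<Longrightarrow> x \<in> cells X 0 \<Longrightarrow> const_cell (X, x) k \<in> cells X k"
  by (simp add: const_cell_conv act_cell const0_box_hom)

lemma act_const_cell:
  assumes "cubical_set X" "x \<in> cells X 0" "\<phi> \<in> box_hom j k"
  shows "act X j k \<phi> (const_cell (X, x) k) = const_cell (X, x) j"
  using assms by (simp add: const_cell_conv act_act const0_box_hom
      box_hom_0_unique[OF compose_box_hom[OF _ const0_box_hom]])

lemma const_cell_map:
  assumes "p \<in> cmaps X Y" "x \<in> cells X 0"
  shows "p k (const_cell (X, x) k) = const_cell (Y, p 0 x) k"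
  using assms by (simp add: const_cell_conv cmaps_act const0_box_hom)

text \<open>A face becomes a condition on one coordinate, which is easy to test on composites. For
  the converse, deleting the constant coordinate and inserting it again gives the cell back.\<close>

lemma face_image_iff:
  assumes "i \<in> {1..Suc n}"
  shows "c \<in> face_image (Suc n) i \<epsilon> k \<longleftrightarrow>
    c \<in> box_hom k (Suc n) \<and> (\<forall>v. length v = k \<longrightarrow> c v ! (i - 1) = \<epsilon>)" (is "?L = ?R")
proof
  assume ?L
  then obtain d where d: "d \<in> box_hom k n" "c = compose (vert k) (face (Suc n) i \<epsilon>) d"
    by (auto simp: face_image_def)
  then show ?R
    using assms compose_box_hom[OF d(1) face_Suc_box_hom[OF assms]]
    by (auto simp: compose_def face_def box_hom_length[OF d(1)] nth_append min_def)
next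
  assume R: ?R
  let ?d = "compose (vert k) (degen (Suc n) i) c"
  have d: "?d \<in> box_hom k n" using R degen_Suc_box_hom[OF assms] compose_box_hom by blast
  have "c = compose (vert k) (face (Suc n) i \<epsilon>) ?d"
  proof (rule vert_ext[of _ k])
    fix v :: "bool list" assume v: "length v = k"
    have l: "length (c v) = Suc n" using R v box_hom_length by blast
    have "c v = take (i - 1) (c v) @ [c v ! (i - 1)] @ drop i (c v)"
    proof -
      have "i - 1 < length (c v)" "Suc (i - 1) = i" using assms l by auto
      then show ?thesis using id_take_nth_drop[of "i - 1" "c v"] by simp
    qed
    then show "c v = compose (vert k) (face (Suc n) i \<epsilon>) ?d v"
      using R v l assms by (auto simp: compose_def face_def degen_def min_def)
  qed (use R in auto)
  then show ?L unfolding face_image_def using d by auto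
qed

text \<open>On a face the i-th coordinate carries no information, so deleting it loses nothing. This
  makes the factorization through the face explicit.\<close>

lemma face_degen:
  assumes "i \<in> {1..Suc n}" "c \<in> face_image (Suc n) i \<epsilon> k"
  shows "compose (vert k) (face (Suc n) i \<epsilon>) (compose (vert k) (degen (Suc n) i) c) = c"
proof -
  obtain d where d: "d \<in> box_hom k n" "c = compose (vert k) (face (Suc n) i \<epsilon>) d"
    using assms by (auto simp: face_image_def)
  have "compose (vert k) (degen (Suc n) i) c = d"
    using assms(1) d(1) by (intro vert_ext[of _ k]) (auto simp: d(2) compose_def face_def degen_def box_hom_length min_def)
  then show ?thesis using d(2) by simp
qed

text \<open>Once coordinate j is deleted, the former coordinate j' sits at j' - 1.\<close>

lemma compose_degen_degen:
  assumes "1 \<le> j" "j < j'" "j' \<le> Suc (Suc n)"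
  shows "compose (vert (Suc (Suc n))) (degen (Suc n) (j' - 1)) (degen (Suc (Suc n)) j)
    = compose (vert (Suc (Suc n))) (degen (Suc n) j) (degen (Suc (Suc n)) j')"
proof (rule vert_ext[of _ "Suc (Suc n)"])
  fix v :: "bool list" assume v: "length v = Suc (Suc n)"
  obtain i where i: "j = Suc i" using assms by (cases j) auto
  obtain i' where i': "j' = Suc (Suc i')" using assms by (metis i lessE old.nat.exhaust not_less0 Suc_less_eq)
  have le: "i \<le> i'" "i' \<le> n" using assms i i' by auto
  define a where "a = take i v"
  define b where "b = take (i' - i) (drop (Suc i) v)"
  define c where "c = drop (Suc (Suc i')) v"
  have "v = a @ [v ! i] @ drop (Suc i) v" using le v by (simp add: a_def id_take_nth_drop)
  also have "drop (Suc i) v = b @ [v ! Suc i'] @ drop (Suc (Suc i')) v"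
    using le v id_take_nth_drop[of "i' - i" "drop (Suc i) v"] by (simp add: b_def)
  finally have vv: "v = a @ [v ! i] @ b @ [v ! Suc i'] @ c" by (simp add: c_def)
  have la: "length a = i" "length b = i' - i" using le v by (auto simp: a_def b_def)
  obtain e e' where "v = a @ [e] @ b @ [e'] @ c" using vv by blast
  then show "compose (vert (Suc (Suc n))) (degen (Suc n) (j' - 1)) (degen (Suc (Suc n)) j) v
    = compose (vert (Suc (Suc n))) (degen (Suc n) j) (degen (Suc (Suc n)) j') v"
    using v le la by (auto simp: compose_def degen_def i i' Suc_diff_le)
qed auto

section \<open>Open boxes glued from their faces\<close>

lemma cells_open_box [simp]:
  "cells (open_box n i \<epsilon>) k = (\<Union>(j, \<eta>)\<in>{1..n} \<times> UNIV - {(i, \<epsilon>)}. face_image n j \<eta> k)"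
  by (simp add: open_box_def)

lemma act_open_box [simp]: "act (open_box n i \<epsilon>) j k \<phi> c = compose (vert j) c \<phi>"
  by (simp add: open_box_def)

lemma face_image_compose:
  assumes "\<phi> \<in> box_hom j k" "c \<in> face_image n i \<epsilon> k"
  shows "compose (vert j) c \<phi> \<in> face_image n i \<epsilon> j"
proof -
  obtain d where "d \<in> box_hom k (n - 1)" "c = compose (vert k) (face n i \<epsilon>) d"
    using assms(2) by (auto simp: face_image_def)
  then show ?thesis using assms(1)
    by (auto simp: face_image_def compose_assoc_box compose_box_hom)
qed

text \<open>In terms of its \<open>2 N + 1\<close> faces, a map from the open box is a family of
  \<open>N\<close>-cubes agreeing on the common faces.\<close>

lemma Kan_fill:
  assumes Kan: "Kan_complex X" and i: "i \<in> {1..Suc N}"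
    and cell: "\<And>j \<eta>. j \<in> {1..Suc N} \<Longrightarrow> (j, \<eta>) \<noteq> (i, \<epsilon>) \<Longrightarrow> y j \<eta> \<in> cells X N"
    and compat: "\<And>M j \<eta> j' \<eta>'. N = Suc M \<Longrightarrow> 1 \<le> j \<Longrightarrow> j < j' \<Longrightarrow> j' \<le> Suc N \<Longrightarrow>
      (j, \<eta>) \<noteq> (i, \<epsilon>) \<Longrightarrow> (j', \<eta>') \<noteq> (i, \<epsilon>) \<Longrightarrow>
      act X M N (face N (j' - 1) \<eta>') (y j \<eta>) = act X M N (face N j \<eta>) (y j' \<eta>')"
  obtains h where "h \<in> cells X (Suc N)"
    "\<And>j \<eta>. j \<in> {1..Suc N} \<Longrightarrow> (j, \<eta>) \<noteq> (i, \<epsilon>) \<Longrightarrow> act X N (Suc N) (face (Suc N) j \<eta>) h = y j \<eta>"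
proof -
  have X: "cubical_set X" using Kan by (simp add: Kan_complex_def)
  define J where "J = {1..Suc N} \<times> UNIV - {(i, \<epsilon>)}"
  \<comment> \<open>A cell \<open>c\<close> on the face (j, \<eta>) factors through it by deleting
    coordinate j, so a map with faces \<open>y\<close> is forced to take this value on
    \<open>c\<close>.\<close>
  define F where "F k c j \<eta> = act X k N (compose (vert k) (degen (Suc N) j) c) (y j \<eta>)" for k c j \<eta>
  have unique: "F k c j \<eta> = F k c j' \<eta>'"
    if "(j, \<eta>) \<in> J" "(j', \<eta>') \<in> J" "c \<in> face_image (Suc N) j \<eta> k" "c \<in> face_image (Suc N) j' \<eta>' k"
      "j \<le> j'" for k c j \<eta> j' \<eta>'
  proof (cases "j = j'")
    case True
    have "j \<in> {1..Suc N}" using that by (simp add: J_def)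
    then have "\<forall>v. length v = k \<longrightarrow> c v ! (j - 1) = \<eta> \<and> c v ! (j - 1) = \<eta>'"
      using that(3,4) True face_image_iff[of j N c \<eta> k] face_image_iff[of j N c \<eta>' k]
      by simp
    \<comment> \<open>One vertex is enough to tell opposite faces apart; k copies of
      \<open>True\<close> provide it.\<close>
    then have "\<eta> = \<eta>'" using length_replicate[of k True] by (auto simp del: length_replicate)
    then show ?thesis using True by simp
  next
    case False
    then have lt: "j < j'" using that by simp
    have j: "1 \<le> j" "j' \<le> Suc N" "j \<in> {1..Suc N}" "j' \<in> {1..Suc N}" using that lt by (auto simp: J_def)
    then obtain M where M: "N = Suc M" using lt by (cases N) auto
    have c: "c \<in> box_hom k (Suc N)" using that j face_image_iff by blast
    define d where "d = compose (vert k) (degen (Suc N) j) c"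
    define d' where "d' = compose (vert k) (degen (Suc N) j') c"
    have dh: "d \<in> box_hom k N" "d' \<in> box_hom k N"
      using compose_box_hom[OF c degen_Suc_box_hom] j by (auto simp: d_def d'_def)
    have cv: "c v ! (j - 1) = \<eta>" "c v ! (j' - 1) = \<eta>'" "length (c v) = Suc N" if "length v = k" for v
      using \<open>c \<in> face_image (Suc N) j \<eta> k\<close> \<open>c \<in> face_image (Suc N) j' \<eta>' k\<close> that
        box_hom_length[OF c] face_image_iff[OF j(3)] face_image_iff[OF j(4)] by auto
    \<comment> \<open>As \<open>c\<close> lies on both faces, \<open>d\<close> and \<open>d'\<close>
      again lie on faces of the smaller cube, with j' shifted by one in \<open>d\<close>. Both come
      from the cell \<open>e\<close> in which the two coordinates are deleted, and there
      \<open>compat\<close> applies.\<close>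
    have "d \<in> face_image (Suc M) (j' - 1) \<eta>' k"
      using lt j M dh cv by (subst face_image_iff) (auto simp: d_def compose_def degen_def nth_append)
    then have 1: "compose (vert k) (face N (j' - 1) \<eta>') (compose (vert k) (degen N (j' - 1)) d) = d"
      using lt j unfolding M by (intro face_degen) auto
    have "d' \<in> face_image (Suc M) j \<eta> k"
      using lt j M dh cv by (subst face_image_iff) (auto simp: d'_def compose_def degen_def nth_append)
    then have 2: "compose (vert k) (face N j \<eta>) (compose (vert k) (degen N j) d') = d'"
      using lt j unfolding M by (intro face_degen) auto
    define e where "e = compose (vert k) (degen N j) d'"
    have 3: "compose (vert k) (degen N (j' - 1)) d = e"
      using compose_degen_degen[of j j' M] lt j c M
      unfolding d_def d'_def e_def by (simp add: compose_assoc_box[symmetric])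
    have e: "e \<in> box_hom k M"
      unfolding e_def M using j lt dh(2) M by (intro compose_box_hom[OF _ degen_Suc_box_hom]) auto
    have fh: "face N (j' - 1) \<eta>' \<in> box_hom M N" "face N j \<eta> \<in> box_hom M N"
      using j lt unfolding M by (auto intro!: face_Suc_box_hom)
    have "F k c j \<eta> = act X k M e (act X M N (face N (j' - 1) \<eta>') (y j \<eta>))"
      using 1 3 e fh cell[of j \<eta>] that by (simp add: F_def d_def[symmetric] act_act[OF X] J_def)
    also have "act X M N (face N (j' - 1) \<eta>') (y j \<eta>) = act X M N (face N j \<eta>) (y j' \<eta>')"
      using compat[OF M j(1) lt j(2)] that by (simp add: J_def)
    also have "act X k M e (act X M N (face N j \<eta>) (y j' \<eta>')) = F k c j' \<eta>'"
      using 2 e fh cell[of j' \<eta>'] that by (simp add: F_def d'_def[symmetric] e_def[symmetric] act_act[OF X] J_def)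
    finally show ?thesis .
  qed
  \<comment> \<open>The value is taken on some face containing \<open>c\<close>; by
    \<open>unique\<close> it is the same on all of them.\<close>
  define f where "f k = (\<lambda>c\<in>cells (open_box (Suc N) i \<epsilon>) k.
    case (SOME (j, \<eta>). (j, \<eta>) \<in> J \<and> c \<in> face_image (Suc N) j \<eta> k) of (j, \<eta>) \<Rightarrow> F k c j \<eta>)" for k
  have f: "f k c = F k c j \<eta>" if "(j, \<eta>) \<in> J" "c \<in> face_image (Suc N) j \<eta> k" for k c j \<eta>
  proof -
    obtain j' \<eta>' where s: "(SOME (j, \<eta>). (j, \<eta>) \<in> J \<and> c \<in> face_image (Suc N) j \<eta> k) = (j', \<eta>')"
      by (rule prod.exhaust)
    have "(\<lambda>(j, \<eta>). (j, \<eta>) \<in> J \<and> c \<in> face_image (Suc N) j \<eta> k) (j', \<eta>')"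
      unfolding s[symmetric] by (rule someI[of _ "(j, \<eta>)"]) (simp add: that)
    then have s': "(j', \<eta>') \<in> J" "c \<in> face_image (Suc N) j' \<eta>' k" by simp_all
    have "F k c j \<eta> = F k c j' \<eta>'"
    proof (cases "j \<le> j'")
      case True
      then show ?thesis by (rule unique[OF that(1) s'(1) that(2) s'(2)])
    next
      case False
      then have "j' \<le> j" by simp
      then show ?thesis by (rule unique[OF s'(1) that(1) s'(2) that(2), symmetric])
    qed
    moreover have "c \<in> cells (open_box (Suc N) i \<epsilon>) k"
      using that unfolding J_def cells_open_box by blast
    ultimately show ?thesis by (simp only: f_def s restrict_apply' prod.case)
  qed
  have box: "\<exists>j \<eta>. (j, \<eta>) \<in> J \<and> c \<in> face_image (Suc N) j \<eta> k"
    if "c \<in> cells (open_box (Suc N) i \<epsilon>) k" for c k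
    using that unfolding J_def cells_open_box by blast
  have "f \<in> cmaps (open_box (Suc N) i \<epsilon>) X"
    unfolding cmaps_def
  proof (intro CollectI conjI allI ballI PiE_I)
    fix k c assume "c \<in> cells (open_box (Suc N) i \<epsilon>) k"
    then obtain j \<eta> where j: "(j, \<eta>) \<in> J" "c \<in> face_image (Suc N) j \<eta> k" using box by blast
    then have "c \<in> box_hom k (Suc N)" "j \<in> {1..Suc N}" using face_image_iff by (auto simp: J_def)
    then show "f k c \<in> cells X k"
      using j cell[of j \<eta>] act_cell[OF X compose_box_hom[OF _ degen_Suc_box_hom]]
      by (simp add: f[OF j] F_def) (simp add: J_def)
  next
    fix k c assume "c \<notin> cells (open_box (Suc N) i \<epsilon>) k"
    then show "f k c = undefined" by (simp only: f_def restrict_def if_False)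
  next
    fix l k \<phi> c assume \<phi>: "\<phi> \<in> box_hom l k" and "c \<in> cells (open_box (Suc N) i \<epsilon>) k"
    then obtain j \<eta> where j: "(j, \<eta>) \<in> J" "c \<in> face_image (Suc N) j \<eta> k" using box by blast
    then have "c \<in> box_hom k (Suc N)" "j \<in> {1..Suc N}" using face_image_iff by (auto simp: J_def)
    then show "f l (act (open_box (Suc N) i \<epsilon>) l k \<phi> c) = act X l k \<phi> (f k c)"
      using \<phi> j cell[of j \<eta>] f[OF j(1) face_image_compose[OF \<phi> j(2)]]
        compose_box_hom[OF _ degen_Suc_box_hom]
      by (simp add: f[OF j] F_def J_def act_act[OF X] compose_assoc_box)
  qed
  then obtain g where g: "g \<in> cmaps (cube (Suc N)) X"
    "\<And>k c. c \<in> cells (open_box (Suc N) i \<epsilon>) k \<Longrightarrow> g k c = f k c"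
    using Kan i unfolding Kan_complex_def by (metis One_nat_def Suc_le_mono zero_le)
  show ?thesis
  proof
    \<comment> \<open>By Yoneda, the cube that fills the box is the value of the extension at the
      identity.\<close>
    show "top_cell (Suc N) g \<in> cells X (Suc N)"
      using cmaps_cell[OF g(1)] by (simp add: top_cell_def)
    fix j \<eta> assume j: "j \<in> {1..Suc N}" "(j, \<eta>) \<noteq> (i, \<epsilon>)"
    let ?c = "face (Suc N) j \<eta>"
    have J: "(j, \<eta>) \<in> J" using j by (simp add: J_def)
    have c: "?c \<in> face_image (Suc N) j \<eta> N"
      using face_Suc_box_hom[OF j(1)] compose_idm_right[OF face_Suc_box_hom[OF j(1)]]
      unfolding face_image_def by (metis diff_Suc_1 idm_box_hom image_eqI)
    have "compose (vert N) (degen (Suc N) j) ?c = idm N"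
      using j by (intro vert_ext[of _ N]) (auto simp: compose_def degen_def face_def idm_def min_def)
    then have "F N ?c j \<eta> = y j \<eta>" using cell j by (simp add: F_def act_idm[OF X])
    moreover have "?c \<in> cells (open_box (Suc N) i \<epsilon>) N" using c J by (auto simp: J_def)
    ultimately show "act X N (Suc N) ?c (top_cell (Suc N) g) = y j \<eta>"
      using g(2) f[OF J c] cmaps_cube_apply[OF g(1) face_Suc_box_hom[OF j(1)], of \<eta>] by presburger
  qed
qed


section \<open>Loop spaces\<close>

lemma cells_loop:
  "cells (fst (loop P)) k = {c \<in> cells (fst P) (Suc k).
    \<forall>\<epsilon>. act (fst P) k (Suc k) (face (Suc k) 1 \<epsilon>) c = const_cell P k}"
proof -
  have "(\<forall>\<epsilon>. P \<epsilon>) \<longleftrightarrow> P False \<and> P True" for P :: "bool \<Rightarrow> bool" by (metis (full_types))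
  then show ?thesis
    using box_tensor_face_left[of 1 1 k] by (cases P) (auto simp: loop_def path_object_def path_end_def)
qed

lemma act_loop:
  "act (fst (loop P)) j k \<phi> = act (fst P) (Suc j) (Suc k) (box_tensor 1 j (idm 1) \<phi>)"
  by (cases P) (simp add: loop_def path_object_def)

lemma snd_loop: "snd (loop P) = const_cell P 1"
proof -
  have "degen 1 1 = const0 1"
    by (rule box_hom_0_unique) (use degen_Suc_box_hom[of 1 0] in simp)
  then show ?thesis by (cases P) (simp add: loop_def const_cell_conv)
qed

lemma pointed_loop:
  assumes "pointed P" shows "pointed (loop P)"
proof -
  obtain X x where P: "P = (X, x)" by (rule prod.exhaust)
  have X: "cubical_set X" and x: "x \<in> cells X 0" using assms by (auto simp: P pointed_def)
  let ?L = "fst (loop (X, x))"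
  have T: "box_tensor 1 m (idm 1) \<phi> \<in> box_hom (Suc m) (Suc n)" if "\<phi> \<in> box_hom m n" for m n \<phi>
    using box_tensor_idm_left[OF that, of 1] by simp
  have "cubical_set ?L"
    unfolding cubical_set_def
  proof (intro conjI allI ballI)
    fix m n \<phi> c assume \<phi>: "\<phi> \<in> box_hom m n" and c: "c \<in> cells ?L n"
    then have cX: "c \<in> cells X (Suc n)" by (simp add: cells_loop)
    have "act X m (Suc m) (face (Suc m) 1 \<epsilon>) (act X (Suc m) (Suc n) (box_tensor 1 m (idm 1) \<phi>) c)
      = const_cell (X, x) m" for \<epsilon>
    proof -
      have f: "face (Suc k) 1 \<epsilon> = box_tensor 0 k (face 1 1 \<epsilon>) (idm k)" for k
        using box_tensor_face_left[of 1 1 k \<epsilon>] by simp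
      have h: "face 1 1 \<epsilon> \<in> box_hom 0 1" using face_Suc_box_hom[of 1 0 \<epsilon>] by simp
      \<comment> \<open>The loop face and the operator concern disjoint coordinates: both composites
        equal the product of \<open>face 1 1 \<epsilon>\<close> and \<phi>.\<close>
      have "compose (vert m) (box_tensor 1 m (idm 1) \<phi>) (face (Suc m) 1 \<epsilon>)
        = compose (vert m) (face (Suc n) 1 \<epsilon>) \<phi>"
        using box_tensor_compose[of "face 1 1 \<epsilon>" 0 1 "idm m" m m "idm 1" \<phi>]
          box_tensor_compose[of "idm 0" 0 0 \<phi> m n "face 1 1 \<epsilon>" "idm n"] h \<phi>
        by (simp add: f compose_idm_left compose_idm_right box_tensor_0_left
            del: One_nat_def)
      then show ?thesis
        using c cX \<phi> T[OF \<phi>] face_Suc_box_hom[of 1 m \<epsilon>] face_Suc_box_hom[of 1 n \<epsilon>]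
        by (simp add: act_act[OF X] cells_loop del: One_nat_def)
          (simp add: act_act[OF X, symmetric] act_const_cell[OF X x])
    qed
    then show "act ?L m n \<phi> c \<in> cells ?L m"
      using cX T[OF \<phi>] by (simp add: cells_loop act_loop act_cell[OF X])
  next
    fix n c assume "c \<in> cells ?L n"
    then show "act ?L n n (idm n) c = c"
      using box_tensor_idm[of 1 n] by (simp add: act_loop cells_loop act_idm[OF X])
  next
    fix l m n \<phi> \<psi> c
    assume "\<phi> \<in> box_hom l m" "\<psi> \<in> box_hom m n" "c \<in> cells ?L n"
    then show "act ?L l n (compose (vert l) \<psi> \<phi>) c = act ?L l m \<phi> (act ?L m n \<psi> c)"
      using T[of \<phi> l m] T[of \<psi> m n] box_tensor_compose[of "idm 1" 1 1 \<phi> l m "idm 1" \<psi>]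
      by (simp add: act_loop cells_loop act_act[OF X] compose_idm_left)
  qed
  moreover have "snd (loop (X, x)) \<in> cells ?L 0"
    unfolding snd_loop
    using const_cell_cell[OF X x] act_const_cell[OF X x] face_Suc_box_hom[of 1 0]
    by (simp add: cells_loop)
  ultimately show ?thesis by (simp add: pointed_def P case_prod_beta)
qed

lemma loops_0 [simp]: "loops 0 P = P"
  and loops_Suc: "loops (Suc n) P = loop (loops n P)"
  by (simp_all add: loops_def)

lemma pointed_loops: "pointed P \<Longrightarrow> pointed (loops n P)"
  by (induction n) (simp_all add: loops_Suc pointed_loop)

lemma cubical_set_loops: "pointed P \<Longrightarrow> cubical_set (fst (loops n P))"
  using pointed_loops[of P n] by (simp add: pointed_def case_prod_beta)

text \<open>Each new loop direction is the first of the directions still free, so it comes right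
  after the earlier loop directions, and operators of the n-fold loop space act on the last
  coordinates of a cube of X.\<close>

lemma act_loops:
  "\<phi> \<in> box_hom j k \<Longrightarrow>
    act (fst (loops n (X, x))) j k \<phi> = act X (n + j) (n + k) (box_tensor n j (idm n) \<phi>)"
proof (induction n arbitrary: j k \<phi>)
  case 0
  then show ?case by (simp add: box_tensor_0_left)
next
  case (Suc n)
  then show ?case
    using box_tensor_assoc_idm[of n 1 j \<phi>] box_tensor_idm_left[of \<phi> j k 1]
    by (simp add: loops_Suc act_loop)
qed

lemma const_cell_loops:
  assumes "pointed (X, x)"
  shows "const_cell (loops n (X, x)) k = const_cell (X, x) (n + k)"
proof -
  have X: "cubical_set X" and x: "x \<in> cells X 0" using assms by (auto simp: pointed_def)
  \<comment> \<open>The base point determines all constant cubes, and the base point of the next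
    loop space is the constant 1-cube of the present one. Hence the induction below is on the base
    point alone and uses this fact at k = 1.\<close>
  have *: "const_cell (loops n (X, x)) k = const_cell (X, x) (n + k)"
    if "snd (loops n (X, x)) = const_cell (X, x) n" for n k
    using const_cell_conv[of "fst (loops n (X, x))" "const_cell (X, x) n" k]
      act_loops[OF const0_box_hom, of n X x k]
      act_const_cell[OF X x box_tensor_idm_left[OF const0_box_hom], of n k]
    by (simp flip: that)
  have "snd (loops n (X, x)) = const_cell (X, x) n"
  proof (induction n)
    case 0
    have "const0 0 = idm 0" by (rule box_hom_0_unique[symmetric]) simp
    then show ?case by (simp add: const_cell_conv act_idm[OF X x])
  next
    case (Suc n)
    then show ?case using *[of n 1] by (simp add: loops_Suc snd_loop)
  qed
  then show ?thesis by (rule *)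
qed

text \<open>Passing from n to n + 1 adds a condition on the first free direction, which is
  coordinate n + 1 in X. The index \<open>n + k - 1\<close> occurs only for n > 0, since the range
  of i is empty otherwise, so the subtraction is never truncated where it is used.\<close>

lemma cells_loops:
  assumes "pointed (X, x)"
  shows "cells (fst (loops n (X, x))) k = {c \<in> cells X (n + k).
    \<forall>i\<in>{1..n}. \<forall>\<epsilon>. act X (n + k - 1) (n + k) (face (n + k) i \<epsilon>) c = const_cell (X, x) (n + k - 1)}"
proof (induction n arbitrary: k)
  case 0
  then show ?case by simp
next
  case (Suc n)
  have "act (fst (loops n (X, x))) k (Suc k) (face (Suc k) 1 \<epsilon>)
    = act X (n + k) (Suc (n + k)) (face (Suc (n + k)) (Suc n) \<epsilon>)" for \<epsilon>
    using act_loops[OF face_Suc_box_hom, of 1 k n X x \<epsilon>] box_tensor_face_right[of 1 "Suc k" n \<epsilon>]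
    by simp
  moreover have "(\<forall>i\<in>{1..Suc n}. P i) \<longleftrightarrow> (\<forall>i\<in>{1..n}. P i) \<and> P (Suc n)" for P
    by (simp add: atLeastAtMostSuc_conv conj_commute)
  ultimately show ?case
    using Suc[of "Suc k"]
    by (auto simp: loops_Suc cells_loop const_cell_loops[OF assms] simp del: One_nat_def)
qed

lemma cells_loops_0:
  assumes "pointed (X, x)"
  shows "cells (fst (loops n (X, x))) 0 = {c \<in> cells X n.
    \<forall>i\<in>{1..n}. \<forall>\<epsilon>. act X (n - 1) n (face n i \<epsilon>) c = const_cell (X, x) (n - 1)}"
  using cells_loops[OF assms, of n 0] by simp


section \<open>The edge relation\<close>

definition edge_rel :: "'a cset \<Rightarrow> ('a \<times> 'a) set" where
  "edge_rel L = {(act L 0 1 (face 1 1 False) h, act L 0 1 (face 1 1 True) h) | h. h \<in> cells L 1}"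

lemma edge_rel_loops_iff:
  assumes "pointed (X, x)"
  shows "(a, b) \<in> edge_rel (fst (loops n (X, x))) \<longleftrightarrow> (\<exists>h\<in>cells X (Suc n).
    (\<forall>i\<in>{1..n}. \<forall>\<epsilon>. act X n (Suc n) (face (Suc n) i \<epsilon>) h = const_cell (X, x) n) \<and>
    act X n (Suc n) (face (Suc n) (Suc n) False) h = a \<and>
    act X n (Suc n) (face (Suc n) (Suc n) True) h = b)"
proof -
  have "act (fst (loops n (X, x))) 0 1 (face 1 1 \<epsilon>) = act X n (Suc n) (face (Suc n) (Suc n) \<epsilon>)" for \<epsilon>
    using act_loops[OF face_Suc_box_hom, of 1 0 n X x \<epsilon>] box_tensor_face_right[of 1 1 n \<epsilon>]
    by simp
  then show ?thesis
    by (auto simp: edge_rel_def cells_loops[OF assms])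
qed

lemma edge_rel_subset: "cubical_set L \<Longrightarrow> edge_rel L \<subseteq> cells L 0 \<times> cells L 0"
  using face_Suc_box_hom[of 1 0] by (auto simp: edge_rel_def act_cell)

lemma edge_rel_refl:
  assumes "cubical_set L" "a \<in> cells L 0"
  shows "(a, a) \<in> edge_rel L"
proof -
  have "act L 0 1 (face 1 1 \<epsilon>) (act L 1 0 (const0 1) a) = a" for \<epsilon>
  proof -
    have "face 1 1 \<epsilon> \<in> box_hom 0 1" using face_Suc_box_hom[of 1 0 \<epsilon>] by simp
    moreover from this have "compose (vert 0) (const0 1) (face 1 1 \<epsilon>) = idm 0"
      using box_hom_0_unique[OF compose_box_hom[OF _ const0_box_hom]] box_hom_0_unique[of "idm 0" 0]
      by simp
    ultimately show ?thesis using assms by (simp add: act_act const0_box_hom act_idm)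
  qed
  moreover have "act L 1 0 (const0 1) a \<in> cells L 1" using assms by (simp add: act_cell const0_box_hom)
  ultimately show ?thesis unfolding edge_rel_def by (intro CollectI exI[of _ "act L 1 0 (const0 1) a"]) simp
qed

text \<open>The filled box is an \<open>(n + 2)\<close>-cube with constant faces in the first \<open>n\<close> directions. In the
  last two directions it is a square with sides \<open>a \<rightarrow> b\<close>, \<open>a \<rightarrow> c\<close> and the constant
  path at \<open>b\<close>; the missing side is the desired path \<open>c \<rightarrow> b\<close>.\<close>

lemma edge_rel_loops_euclidean:
  assumes Kan: "Kan_complex X" and P: "pointed (X, x)"
    and ab: "(a, b) \<in> edge_rel (fst (loops n (X, x)))"
    and ac: "(a, c) \<in> edge_rel (fst (loops n (X, x)))"
  shows "(c, b) \<in> edge_rel (fst (loops n (X, x)))"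
proof -
  have X: "cubical_set X" and x: "x \<in> cells X 0" using P by (auto simp: pointed_def)
  let ?k = "\<lambda>j. const_cell (X, x) j"
  have "b \<in> cells (fst (loops n (X, x))) 0"
    using edge_rel_subset[OF cubical_set_loops[OF P]] ab by blast
  then have bb: "(b, b) \<in> edge_rel (fst (loops n (X, x)))"
    by (rule edge_rel_refl[OF cubical_set_loops[OF P]])
  define d where "d = (\<lambda>h i \<epsilon>. act X n (Suc n) (face (Suc n) i \<epsilon>) h)"
  obtain h1 where h1: "h1 \<in> cells X (Suc n)" "\<And>i \<epsilon>. i \<in> {1..n} \<Longrightarrow> d h1 i \<epsilon> = ?k n"
    "d h1 (Suc n) False = a" "d h1 (Suc n) True = b"
    using ab unfolding edge_rel_loops_iff[OF P] d_def by blast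
  obtain h2 where h2: "h2 \<in> cells X (Suc n)" "\<And>i \<epsilon>. i \<in> {1..n} \<Longrightarrow> d h2 i \<epsilon> = ?k n"
    "d h2 (Suc n) False = a" "d h2 (Suc n) True = c"
    using ac unfolding edge_rel_loops_iff[OF P] d_def by blast
  obtain h3 where h3: "h3 \<in> cells X (Suc n)" "\<And>i \<epsilon>. i \<in> {1..n} \<Longrightarrow> d h3 i \<epsilon> = ?k n"
    "d h3 (Suc n) False = b" "d h3 (Suc n) True = b"
    using bb unfolding edge_rel_loops_iff[OF P] d_def by blast
  have k: "d (?k (Suc n)) i \<epsilon> = ?k n" if "i \<in> {1..Suc n}" for i \<epsilon>
    unfolding d_def using act_const_cell[OF X x face_Suc_box_hom[OF that]] .
  \<comment> \<open>In direction n + 1 the face of value 0 is \<open>h2\<close>, from a to c, and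
    the face of value 1 is \<open>h3\<close>, from b to b, both running along direction n + 2. In
    direction n + 2 the face of value 0 is \<open>h1\<close>, from a to b. The value
    \<open>h1\<close> at the missing opposite face is a default.\<close>
  define y where "y = (\<lambda>j \<eta>. if j \<le> n then ?k (Suc n) else if j = Suc n then (if \<eta> then h3 else h2) else h1)"
  have "\<exists>h\<in>cells X (Suc (Suc n)). \<forall>j \<eta>. j \<in> {1..Suc (Suc n)} \<longrightarrow> (j, \<eta>) \<noteq> (Suc (Suc n), True) \<longrightarrow>
      act X (Suc n) (Suc (Suc n)) (face (Suc (Suc n)) j \<eta>) h = y j \<eta>"
  proof (rule Kan_fill[OF Kan, of "Suc (Suc n)" "Suc n" True y])
    show "y j \<eta> \<in> cells X (Suc n)" for j \<eta>
      using h1 h2 h3 const_cell_cell[OF X x] by (simp add: y_def)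
    fix M j \<eta> j' \<eta>' assume *: "Suc n = Suc M" "1 \<le> j" "j < j'" "j' \<le> Suc (Suc n)"
      "(j, \<eta>) \<noteq> (Suc (Suc n), True)" "(j', \<eta>') \<noteq> (Suc (Suc n), True)"
    have "d (y j \<eta>) (j' - 1) \<eta>' = d (y j' \<eta>') j \<eta>"
    proof (cases "j \<le> n")
      case True
      then have "d (y j' \<eta>') j \<eta> = ?k n" using * h1 h2 h3 k by (simp add: y_def)
      moreover have "j' - 1 \<in> {1..Suc n}" using * by auto
      ultimately show ?thesis using True k by (simp add: y_def)
    next
      case False
      \<comment> \<open>What remains are the two corners a and b, at the ends of
        \<open>h1\<close>.\<close>
      then have "j = Suc n" "j' = Suc (Suc n)" "\<not> \<eta>'" using * by auto
      then show ?thesis using h1 h2 h3 by (simp add: y_def)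
    qed
    then show "act X M (Suc n) (face (Suc n) (j' - 1) \<eta>') (y j \<eta>)
        = act X M (Suc n) (face (Suc n) j \<eta>) (y j' \<eta>')"
      using * by (simp add: d_def)
  qed auto
  then obtain h where h: "h \<in> cells X (Suc (Suc n))"
    "\<And>j \<eta>. j \<in> {1..Suc n} \<Longrightarrow> act X (Suc n) (Suc (Suc n)) (face (Suc (Suc n)) j \<eta>) h = y j \<eta>"
    by force
  define g where "g = act X (Suc n) (Suc (Suc n)) (face (Suc (Suc n)) (Suc (Suc n)) True) h"
  have g: "g \<in> cells X (Suc n)"
    unfolding g_def using X face_Suc_box_hom h(1) by (rule act_cell) auto
  \<comment> \<open>Exchanging two face maps, a face of the missing side is the final face of the
    given side in the same direction. For j = n + 1 these are the end c of \<open>h2\<close> and the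
    end b of \<open>h3\<close>.\<close>
  have dg: "d g j \<eta> = d (y j \<eta>) (Suc n) True" if j: "j \<in> {1..Suc n}" for j \<eta>
  proof -
    have f: "face (Suc n) j \<eta> \<in> box_hom n (Suc n)" "face (Suc n) (Suc n) True \<in> box_hom n (Suc n)"
      "face (Suc (Suc n)) j \<eta> \<in> box_hom (Suc n) (Suc (Suc n))"
      "face (Suc (Suc n)) (Suc (Suc n)) True \<in> box_hom (Suc n) (Suc (Suc n))"
      using j by (auto intro!: face_Suc_box_hom)
    have "d g j \<eta> = act X n (Suc (Suc n))
        (compose (vert n) (face (Suc (Suc n)) (Suc (Suc n)) True) (face (Suc n) j \<eta>)) h"
      unfolding d_def g_def by (rule act_act[OF X f(1) f(4) h(1)])
    also have "\<dots> = act X n (Suc (Suc n))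
        (compose (vert n) (face (Suc (Suc n)) j \<eta>) (face (Suc n) (Suc n) True)) h"
      using compose_face_face[of j "Suc (Suc n)" n \<eta> True] j by simp
    also have "\<dots> = d (y j \<eta>) (Suc n) True"
      unfolding d_def h(2)[OF j, symmetric] by (rule act_act[OF X f(2) f(3) h(1), symmetric])
    finally show ?thesis .
  qed
  have "d g i \<epsilon> = ?k n" if "i \<in> {1..n}" for i \<epsilon>
    using that dg[of i \<epsilon>] k[of "Suc n" True] by (simp add: y_def)
  moreover have "d g (Suc n) False = c" "d g (Suc n) True = b"
    using dg[of "Suc n"] h2(4) h3(4) by (simp_all add: y_def)
  ultimately show ?thesis
    using g unfolding edge_rel_loops_iff[OF P] d_def by blast
qed

text \<open>A reflexive Euclidean relation is symmetric, by taking one of the two edges to be (a,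
  a), and then transitive.\<close>

lemma equiv_edge_rel_loops:
  assumes "Kan_complex X" and P: "pointed (X, x)"
  shows "equiv (cells (fst (loops n (X, x))) 0) (edge_rel (fst (loops n (X, x))))"
proof (rule equivI)
  let ?L = "fst (loops n (X, x))"
  note L = cubical_set_loops[OF P, of n]
  note euclidean = edge_rel_loops_euclidean[OF assms]
  show "edge_rel ?L \<subseteq> cells ?L 0 \<times> cells ?L 0" by (rule edge_rel_subset[OF L])
  show "refl_on (cells ?L 0) (edge_rel ?L)" by (auto simp: refl_on_def edge_rel_refl[OF L])
  have sym: "(b, a) \<in> edge_rel ?L" if "(a, b) \<in> edge_rel ?L" for a b
    using euclidean[OF _ that, of a] that edge_rel_refl[OF L, of a] edge_rel_subset[OF L] by blast
  show "sym (edge_rel ?L)" by (rule symI) (rule sym)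
  show "trans (edge_rel ?L)" by (rule transI) (meson sym euclidean)
qed


section \<open>Connected components\<close>

lemma gen_equiv_equiv: "equiv UNIV (gen_equiv R)"
  unfolding gen_equiv_def
  by (intro equivI) (auto simp: refl_on_def intro!: sym_rtrancl trans_rtrancl sym_Un_converse)

lemma gen_equiv_refl [simp]: "(s, s) \<in> gen_equiv R"
  by (simp add: gen_equiv_def)

lemma gen_equiv_base: "(s, t) \<in> R \<Longrightarrow> (s, t) \<in> gen_equiv R"
  by (auto simp: gen_equiv_def)

lemma gen_equiv_class_eq_iff:
  "gen_equiv R `` {s} = gen_equiv R `` {t} \<longleftrightarrow> (s, t) \<in> gen_equiv R"
  using eq_equiv_class_iff[OF gen_equiv_equiv, of s t R] by simp

lemma gen_equiv_map:
  assumes "(s, t) \<in> gen_equiv R" and "\<And>s t. (s, t) \<in> R \<Longrightarrow> (F s, F t) \<in> gen_equiv S"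
  shows "(F s, F t) \<in> gen_equiv S"
  using assms(1) unfolding gen_equiv_def[of R]
proof induction
  case (step t u)
  note S = gen_equiv_equiv[of S]
  from step(2) have "(F t, F u) \<in> gen_equiv S"
    using assms(2) S by (auto simp: equiv_def dest: symD)
  then show ?case using step(3) S by (auto simp: equiv_def dest: transD)
qed simp

text \<open>Functions constant on generating pairs descend to classes. Both the colimit defining
  \<open>pi0\<close> and the coend defining \<open>geom_prod\<close> are mapped out of in this
  way.\<close>

lemma gen_equiv_invariant:
  assumes "(s, t) \<in> gen_equiv R" and "\<And>s t. (s, t) \<in> R \<Longrightarrow> F s = F t"
  shows "F s = F t"
  using assms(1) unfolding gen_equiv_def
  by induction (auto dest: assms(2))

lemma pi0_class_eq_iff: "pi0_class L s = pi0_class L t \<longleftrightarrow> (s, t) \<in> gen_equiv (pi0_rel L)"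
  unfolding pi0_class_def by (rule gen_equiv_class_eq_iff)

lemma pi0_class_act:
  "\<phi> \<in> box_hom m n \<Longrightarrow> c \<in> cells L n \<Longrightarrow> pi0_class L (m, act L m n \<phi> c) = pi0_class L (n, c)"
  unfolding pi0_class_eq_iff by (rule gen_equiv_base) (auto simp: pi0_rel_def)

text \<open>\<open>pi0_map\<close> is a union over all representatives of a class. Compatibility
  with the operators makes the united classes equal, so one representative computes the
  value.\<close>

lemma pi0_map_class:
  assumes "\<And>m n \<phi> c. \<phi> \<in> box_hom m n \<Longrightarrow> c \<in> cells L n \<Longrightarrow> g m (act L m n \<phi> c) = act M m n \<phi> (g n c)"
    and "\<And>n c. c \<in> cells L n \<Longrightarrow> g n c \<in> cells M n"
  shows "pi0_map M g (pi0_class L (k, c)) = pi0_class M (k, g k c)"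
proof -
  have "pi0_class M (j, g j d) = pi0_class M (k, g k c)" if "(j, d) \<in> pi0_class L (k, c)" for j d
  proof -
    have "((k, c), (j, d)) \<in> gen_equiv (pi0_rel L)" using that by (simp add: pi0_class_def)
    then have "pi0_class M (case (k, c) of (k, c) \<Rightarrow> (k, g k c)) = pi0_class M (case (j, d) of (k, c) \<Rightarrow> (k, g k c))"
      by (rule gen_equiv_invariant) (auto simp: pi0_rel_def assms pi0_class_act)
    then show ?thesis by simp
  qed
  moreover have "(k, c) \<in> pi0_class L (k, c)" by (simp add: pi0_class_def)
  ultimately show ?thesis unfolding pi0_map_def by blast
qed

text \<open>The map that fixes the coordinates in \<open>a\<close> and \<open>b\<close> and keeps
  one free is a product of two points and an identity, hence a box morphism; restricting
  \<open>c\<close> along it gives the edge.\<close>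

lemma edge_rel_adjacent:
  assumes L: "cubical_set L" and c: "c \<in> cells L (length (a @ [e] @ b))"
  defines "k \<equiv> length (a @ [e] @ b)"
  shows "(act L 0 k (point (a @ [False] @ b)) c, act L 0 k (point (a @ [True] @ b)) c) \<in> edge_rel L"
proof -
  define \<theta> where "\<theta> = box_tensor 0 (1 + 0) (point a) (box_tensor 1 0 (idm 1) (point b))"
  have \<theta>: "\<theta> \<in> box_hom 1 k"
    using box_tensor_box_hom[OF point_box_hom[of a] box_tensor_box_hom[OF idm_box_hom[of 1] point_box_hom[of b]]]
    by (simp add: \<theta>_def k_def)
  have f: "face 1 1 \<epsilon> \<in> box_hom 0 1" for \<epsilon> using face_Suc_box_hom[of 1 0 \<epsilon>] by simp
  have "compose (vert 0) \<theta> (face 1 1 \<epsilon>) = point (a @ [\<epsilon>] @ b)" for \<epsilon>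
    by (rule vert_ext[of _ 0])
      (auto simp: \<theta>_def point_def compose_def face_def box_tensor_def idm_def)
  then have *: "act L 0 1 (face 1 1 \<epsilon>) (act L 1 k \<theta> c) = act L 0 k (point (a @ [\<epsilon>] @ b)) c" for \<epsilon>
    using act_act[OF L f \<theta> c[folded k_def]] by simp
  have "act L 1 k \<theta> c \<in> cells L 1" using act_cell[OF L \<theta> c[folded k_def]] .
  then show ?thesis unfolding edge_rel_def *[symmetric] by blast
qed

definition base_vertex :: "'a cset \<Rightarrow> nat \<times> 'a \<Rightarrow> 'a" where
  "base_vertex L = (\<lambda>(k, c). act L 0 k (point (replicate k False)) c)"

lemma base_vertex_cell: "cubical_set L \<Longrightarrow> c \<in> cells L k \<Longrightarrow> base_vertex L (k, c) \<in> cells L 0"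
  using point_box_hom[of "replicate k False"] by (simp add: base_vertex_def act_cell)

lemma base_vertex_0: "cubical_set L \<Longrightarrow> a \<in> cells L 0 \<Longrightarrow> base_vertex L (0, a) = a"
  using box_hom_0_unique[OF point_box_hom[of "[]", simplified]] box_hom_0_unique[of "idm 0" 0]
  by (simp add: base_vertex_def) (metis act_idm)

text \<open>Coordinates are set to \<open>False\<close> one by one from the left; in the induction
  the prefix \<open>a\<close> holds those already treated. Adjacent vertices give an edge from
  \<open>False\<close> to \<open>True\<close>, so a step down needs symmetry.\<close>

lemma vertex_connected:
  assumes L: "cubical_set L" and E: "equiv (cells L 0) (edge_rel L)"
    and c: "c \<in> cells L k" and v: "length v = k"
  shows "(act L 0 k (point v) c, base_vertex L (k, c)) \<in> edge_rel L"
proof -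
  have sym: "sym (edge_rel L)" and trans: "trans (edge_rel L)" using E by (auto simp: equiv_def)
  have "(act L 0 k (point (a @ b)) c, act L 0 k (point (a @ replicate (length b) False)) c) \<in> edge_rel L"
    if "length (a @ b) = k" for a b
    using that
  proof (induction b arbitrary: a)
    case Nil
    then have "act L 0 k (point a) c \<in> cells L 0" using act_cell[OF L _ c] point_box_hom[of a] by simp
    then show ?case using edge_rel_refl[OF L] by simp
  next
    case (Cons e b)
    have "(act L 0 k (point (a @ [e] @ b)) c, act L 0 k (point ((a @ [False]) @ b)) c) \<in> edge_rel L"
    proof (cases e)
      case True
      have "c \<in> cells L (length (a @ [e] @ b))" using Cons.prems c by simp
      from edge_rel_adjacent[OF L this] show ?thesis
        using True sym Cons.prems by (auto dest: symD)
    next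
      case False
      have "act L 0 k (point (a @ [e] @ b)) c \<in> cells L 0"
        using act_cell[OF L _ c] point_box_hom[of "a @ [e] @ b"] Cons.prems by simp
      then show ?thesis using edge_rel_refl[OF L] False by simp
    qed
    moreover have "(act L 0 k (point ((a @ [False]) @ b)) c,
        act L 0 k (point ((a @ [False]) @ replicate (length b) False)) c) \<in> edge_rel L"
      using Cons.prems by (intro Cons.IH) simp
    ultimately show ?case using trans by (auto dest: transD)
  qed
  from this[of "[]" v] show ?thesis using v by (simp add: base_vertex_def)
qed

lemma pi0_class_base_vertex:
  "cubical_set L \<Longrightarrow> c \<in> cells L k \<Longrightarrow> pi0_class L (0, base_vertex L (k, c)) = pi0_class L (k, c)"
  using point_box_hom[of "replicate k False"] by (simp add: base_vertex_def pi0_class_act)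

lemma pi0_eq_image:
  assumes "cubical_set L"
  shows "pi0 L = (\<lambda>a. pi0_class L (0, a)) ` cells L 0"
proof
  show "pi0 L \<subseteq> (\<lambda>a. pi0_class L (0, a)) ` cells L 0"
  proof
    fix C assume "C \<in> pi0 L"
    then obtain k c where "c \<in> cells L k" "C = pi0_class L (k, c)"
      by (auto simp: pi0_def pi0_class_def elim!: quotientE)
    then show "C \<in> (\<lambda>a. pi0_class L (0, a)) ` cells L 0"
      using pi0_class_base_vertex[OF assms] base_vertex_cell[OF assms] by blast
  qed
  show "(\<lambda>a. pi0_class L (0, a)) ` cells L 0 \<subseteq> pi0 L"
    by (auto simp: pi0_def pi0_class_def intro!: quotientI)
qed

text \<open>An edge is identified in the colimit with both of its ends. Conversely, the edge class
  of the initial vertex is constant on generating pairs: the initial vertex of w restricted along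
  \<phi> is the vertex \<phi>(0, ..., 0) of w, which is joined to the initial vertex of w.\<close>

lemma pi0_class_eq_edge_rel:
  assumes L: "cubical_set L" and E: "equiv (cells L 0) (edge_rel L)"
    and a: "a \<in> cells L 0" and b: "b \<in> cells L 0"
  shows "pi0_class L (0, a) = pi0_class L (0, b) \<longleftrightarrow> (a, b) \<in> edge_rel L"
proof
  assume "(a, b) \<in> edge_rel L"
  then obtain h where "h \<in> cells L 1" "a = act L 0 1 (face 1 1 False) h" "b = act L 0 1 (face 1 1 True) h"
    by (auto simp: edge_rel_def)
  then show "pi0_class L (0, a) = pi0_class L (0, b)"
    using face_Suc_box_hom[of 1 0] by (simp add: pi0_class_act)
next
  note eq = equiv_class_eq[OF E]
  have rel: "edge_rel L `` {base_vertex L s} = edge_rel L `` {base_vertex L t}"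
    if st0: "(s, t) \<in> pi0_rel L" for s t
  proof -
    obtain m n \<phi> w where st: "s = (m, act L m n \<phi> w)" "t = (n, w)" and \<phi>: "\<phi> \<in> box_hom m n" and w: "w \<in> cells L n"
      using st0 unfolding pi0_rel_def by blast
    let ?v = "replicate m False"
    have "base_vertex L s = act L 0 n (point (\<phi> ?v)) w"
      using act_act[OF L _ \<phi> w, of "point ?v" 0] point_box_hom[of ?v] compose_point[OF \<phi>]
      by (simp add: st base_vertex_def)
    then show ?thesis
      using vertex_connected[OF L E w, of "\<phi> ?v"] box_hom_length[OF \<phi>] st eq by simp
  qed
  assume "pi0_class L (0, a) = pi0_class L (0, b)"
  then have "edge_rel L `` {base_vertex L (0, a)} = edge_rel L `` {base_vertex L (0, b)}"
    unfolding pi0_class_eq_iff by (rule gen_equiv_invariant) (rule rel)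
  then show "(a, b) \<in> edge_rel L"
    using a b eq_equiv_class[OF _ E] by (simp add: base_vertex_0[OF L])
qed


section \<open>Maps out of spheres and their homotopies\<close>

lemma cells_boundary [simp]: "cells (boundary n) k = (\<Union>i\<in>{1..n}. \<Union>\<epsilon>. face_image n i \<epsilon> k)"
  by (simp add: boundary_def)

lemma face_in_face_image: "i \<in> {1..n} \<Longrightarrow> face n i \<epsilon> \<in> face_image n i \<epsilon> (n - 1)"
  unfolding face_image_def
  by (rule image_eqI[of _ _ "idm (n - 1)"]) (simp_all only: compose_idm_right[OF face_box_hom] idm_box_hom)

lemma sphere_maps_iff:
  "f \<in> sphere_maps n (X, x) \<longleftrightarrow> f \<in> cmaps (cube n) X \<and>
    (\<forall>k i \<epsilon> c. i \<in> {1..n} \<longrightarrow> c \<in> face_image n i \<epsilon> k \<longrightarrow> f k c = const_cell (X, x) k)"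
  unfolding sphere_maps_def rel_maps_def by (fastforce simp: point_sub_def)

lemma top_cell_sphere_map:
  assumes P: "pointed (X, x)" and f: "f \<in> sphere_maps n (X, x)"
  shows "top_cell n f \<in> cells (fst (loops n (X, x))) 0"
proof -
  have fc: "f \<in> cmaps (cube n) X" using f by (simp add: sphere_maps_iff)
  have "act X (n - 1) n (face n i \<epsilon>) (top_cell n f) = const_cell (X, x) (n - 1)" if i: "i \<in> {1..n}" for i \<epsilon>
    using cmaps_cube_apply[OF fc face_box_hom[OF i]] f face_in_face_image[OF i] i
    unfolding sphere_maps_iff by metis
  moreover have "top_cell n f \<in> cells X n" using cmaps_cell[OF fc] by (simp add: top_cell_def)
  ultimately show ?thesis by (simp add: cells_loops_0[OF P])
qed

text \<open>The hypothesis only controls the codimension-one faces of \<open>a\<close>; every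
  boundary cell factors through one of them, and restrictions of constant cubes are
  constant.\<close>

lemma yoneda_sphere_map:
  assumes P: "pointed (X, x)" and a: "a \<in> cells (fst (loops n (X, x))) 0"
  shows "yoneda X n a \<in> sphere_maps n (X, x)"
proof -
  have X: "cubical_set X" and x: "x \<in> cells X 0" using P by (auto simp: pointed_def)
  have aX: "a \<in> cells X n"
    and af: "\<And>i \<epsilon>. i \<in> {1..n} \<Longrightarrow> act X (n - 1) n (face n i \<epsilon>) a = const_cell (X, x) (n - 1)"
    using a by (auto simp: cells_loops_0[OF P])
  have "yoneda X n a k c = const_cell (X, x) k" if i: "i \<in> {1..n}" and c: "c \<in> face_image n i \<epsilon> k" for k i \<epsilon> c
  proof -
    obtain d where d: "d \<in> box_hom k (n - 1)" "c = compose (vert k) (face n i \<epsilon>) d"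
      using c by (auto simp: face_image_def)
    have "c \<in> box_hom k n" unfolding d(2) by (rule compose_box_hom[OF d(1) face_box_hom[OF i]])
    then have "yoneda X n a k c = act X k n c a" by (simp add: yoneda_def)
    also have "\<dots> = act X k (n - 1) d (act X (n - 1) n (face n i \<epsilon>) a)"
      unfolding d(2) by (rule act_act[OF X d(1) face_box_hom[OF i] aX, symmetric])
    also have "\<dots> = const_cell (X, x) k" using af[OF i] act_const_cell[OF X x d(1)] by simp
    finally show ?thesis .
  qed
  then show ?thesis using yoneda_cmaps[OF X aX] by (auto simp: sphere_maps_iff)
qed

lemma top_cell_bij:
  assumes P: "pointed (X, x)"
  shows "bij_betw (top_cell n) (sphere_maps n (X, x)) (cells (fst (loops n (X, x))) 0)"
proof (rule bij_betwI[where g = "yoneda X n"])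
  have X: "cubical_set X" using P by (simp add: pointed_def)
  show "yoneda X n (top_cell n f) = f" if "f \<in> sphere_maps n (X, x)" for f
  proof -
    have f: "f \<in> cmaps (cube n) X" using that by (simp add: sphere_maps_iff)
    then have "top_cell n f \<in> cells X n" using cmaps_cell[OF f] by (simp add: top_cell_def)
    from yoneda_cmaps[OF X this] f show ?thesis
      by (rule cmaps_ext) (simp add: yoneda_def cmaps_cube_apply[OF f])
  qed
  show "top_cell n (yoneda X n a) = a" if "a \<in> cells (fst (loops n (X, x))) 0" for a
    using that by (simp add: cells_loops_0[OF P] top_cell_yoneda[OF X])
qed (auto intro: top_cell_sphere_map[OF P] yoneda_sphere_map[OF P])

section \<open>The geometric product and homotopies as cubes\<close>

lemma tensor_class_eq: "(s, t) \<in> tensor_rel X Y k \<Longrightarrow> tensor_class X Y k s = tensor_class X Y k t"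
  unfolding tensor_class_def gen_equiv_class_eq_iff by (rule gen_equiv_base)

lemma cells_geom_prod: "cells (geom_prod X Y) k = tensor_class X Y k ` pretensor X Y k"
  by (auto simp: geom_prod_def tensor_class_def quotient_def)

text \<open>The action is a union over a whole class. Precomposition with \<psi> carries generating
  pairs to generating pairs, so the union is a single class.\<close>

lemma act_geom_prod:
  assumes \<psi>: "\<psi> \<in> box_hom j k"
  shows "act (geom_prod X Y) j k \<psi> (tensor_class X Y k (m, n, \<phi>, x, y))
    = tensor_class X Y j (m, n, compose (vert j) \<phi> \<psi>, x, y)"
proof -
  define F where "F = (\<lambda>(m, n, \<phi> :: bool list \<Rightarrow> bool list, x, y). (m :: nat, n :: nat, compose (vert j) \<phi> \<psi>, x :: 'a, y :: 'b))"
  have rel: "(F s, F t) \<in> gen_equiv (tensor_rel X Y j)" if st: "(s, t) \<in> tensor_rel X Y k" for s t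
  proof (rule gen_equiv_base)
    obtain m m' n n' \<alpha> \<beta> \<phi> x y where
      s: "s = (m', n', compose (vert k) (box_tensor m n \<alpha> \<beta>) \<phi>, x, y)"
      and t: "t = (m, n, \<phi>, act X m m' \<alpha> x, act Y n n' \<beta> y)"
      and mem: "\<alpha> \<in> box_hom m m'" "\<beta> \<in> box_hom n n'" "\<phi> \<in> box_hom k (m + n)" "x \<in> cells X m'" "y \<in> cells Y n'"
      using st unfolding tensor_rel_def by blast
    have "F s = (m', n', compose (vert j) (box_tensor m n \<alpha> \<beta>) (compose (vert j) \<phi> \<psi>), x, y)"
      unfolding s F_def using \<psi> by (simp add: compose_assoc_box)
    moreover have "F t = (m, n, compose (vert j) \<phi> \<psi>, act X m m' \<alpha> x, act Y n n' \<beta> y)"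
      unfolding t F_def by simp
    ultimately show "(F s, F t) \<in> tensor_rel X Y j"
      using mem compose_box_hom[OF \<psi> mem(3)] unfolding tensor_rel_def by blast
  qed
  let ?t = "(m, n, \<phi>, x, y)"
  have "tensor_class X Y j (F ?t) = tensor_class X Y j (F s)" if "s \<in> tensor_class X Y k ?t" for s
  proof -
    have "(?t, s) \<in> gen_equiv (tensor_rel X Y k)" using that by (simp add: tensor_class_def)
    then show ?thesis
      unfolding tensor_class_def gen_equiv_class_eq_iff by (rule gen_equiv_map) (rule rel)
  qed
  moreover have "?t \<in> tensor_class X Y k ?t" by (simp add: tensor_class_def)
  ultimately have "(\<Union>s\<in>tensor_class X Y k ?t. tensor_class X Y j (F s)) = tensor_class X Y j (F ?t)"
    by (intro UN_constant_eq[of ?t]) (assumption, rule ballI, rule sym)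
  moreover have "act (geom_prod X Y) j k \<psi> C = (\<Union>s\<in>C. tensor_class X Y j (F s))" for C
    by (simp add: geom_prod_def F_def case_prod_beta)
  ultimately have "act (geom_prod X Y) j k \<psi> (tensor_class X Y k ?t) = tensor_class X Y j (F ?t)"
    by simp
  then show ?thesis by (simp add: F_def)
qed

text \<open>The pair of identities is the tautological (n + 1)-cube of the product,
  \<open>T k \<theta>\<close> its restriction along \<theta>, and \<open>h\<close> its image under
  the homotopy. A face of \<open>h\<close> is read off by moving the face map through the tensor
  relation onto one of the factors.\<close>

lemma sphere_htpy_imp_edge_rel:
  assumes P: "pointed (X, x)" and f: "f \<in> sphere_maps n (X, x)" and g: "g \<in> sphere_maps n (X, x)"
    and fg: "(f, g) \<in> sphere_htpy n (X, x)"
  shows "(top_cell n f, top_cell n g) \<in> edge_rel (fst (loops n (X, x)))"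
proof -
  let ?G = "geom_prod (cube n) (cube 1)"
  obtain H where H: "H \<in> rel_homotopies (cube n) (boundary n) X (point_sub (X, x)) f g"
    using fg unfolding sphere_htpy_def rel_htpy_def by fastforce
  then have HG: "H \<in> cmaps ?G X"
    and Hsub: "\<And>k. H k ` cells (geom_prod_sub (cube n) (boundary n) (cube 1)) k \<subseteq> cells (point_sub (X, x)) k"
    and Hend: "\<And>k c. c \<in> box_hom k n \<Longrightarrow> H k (end_incl (cube n) False k c) = f k c"
      "\<And>k c. c \<in> box_hom k n \<Longrightarrow> H k (end_incl (cube n) True k c) = g k c"
    by (simp_all add: rel_homotopies_def rel_maps_def)
  define T where "T k \<theta> = tensor_class (cube n) (cube 1) k (n, 1, \<theta>, idm n, idm 1)" for k \<theta>
  define h where "h = H (Suc n) (T (Suc n) (idm (Suc n)))"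
  have T: "T k \<theta> \<in> cells ?G k" if "\<theta> \<in> box_hom k (Suc n)" for k \<theta>
    using that[unfolded Suc_eq_plus1] unfolding T_def cells_geom_prod
    by (intro imageI) (simp add: pretensor_def del: One_nat_def)
  have act_h: "act X k (Suc n) \<theta> h = H k (T k \<theta>)" if "\<theta> \<in> box_hom k (Suc n)" for k \<theta>
  proof -
    have "act X k (Suc n) \<theta> h = H k (act ?G k (Suc n) \<theta> (T (Suc n) (idm (Suc n))))"
      unfolding h_def using cmaps_act[OF HG that T] by simp
    also have "act ?G k (Suc n) \<theta> (T (Suc n) (idm (Suc n))) = T k \<theta>"
      unfolding T_def act_geom_prod[OF that] compose_idm_left[OF that] ..
    finally show ?thesis .
  qed
  have "h \<in> cells X (Suc n)" unfolding h_def using cmaps_cell[OF HG T] by simp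
  moreover have "act X n (Suc n) (face (Suc n) i \<epsilon>) h = const_cell (X, x) n" if i: "i \<in> {1..n}" for i \<epsilon>
  proof -
    have n: "n - 1 + 1 = n" using i by simp
    \<comment> \<open>With \<alpha> a face and \<beta> an identity, the relation moves the face onto
      the first factor, where it is a boundary cell.\<close>
    have "((n, 1, compose (vert n) (box_tensor (n - 1) 1 (face n i \<epsilon>) (idm 1)) (idm n), idm n, idm 1),
      (n - 1, 1, idm n, act (cube n) (n - 1) n (face n i \<epsilon>) (idm n), act (cube 1) 1 1 (idm 1) (idm 1)))
      \<in> tensor_rel (cube n) (cube 1) n"
      unfolding tensor_rel_def using face_box_hom[OF i, of \<epsilon>] n
      by (intro CollectI exI conjI) (rule refl | simp del: One_nat_def)+
    moreover have "compose (vert n) (box_tensor (n - 1) 1 (face n i \<epsilon>) (idm 1)) (idm n) = face (Suc n) i \<epsilon>"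
      using box_tensor_face_left[OF i, of 1 \<epsilon>] i compose_idm_right[OF face_Suc_box_hom, of i n \<epsilon>] by simp
    ultimately have "T n (face (Suc n) i \<epsilon>)
      = tensor_class (cube n) (cube 1) n (n - 1, 1, idm n, face n i \<epsilon>, idm 1)"
      unfolding T_def using tensor_class_eq compose_idm_left[OF face_box_hom[OF i]]
        compose_idm_left[OF idm_box_hom[of 1]]
      by (metis act_cube)
    also have "\<dots> \<in> cells (geom_prod_sub (cube n) (boundary n) (cube 1)) n"
      using face_in_face_image[OF i, of \<epsilon>] i n
      by (auto simp: geom_prod_sub_def pretensor_def simp del: One_nat_def intro!: imageI)
    finally have "H n (T n (face (Suc n) i \<epsilon>)) \<in> cells (point_sub (X, x)) n" using Hsub by blast
    then show ?thesis using act_h[OF face_Suc_box_hom] i by (simp add: point_sub_def)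
  qed
  moreover have "act X n (Suc n) (face (Suc n) (Suc n) \<epsilon>) h = H n (end_incl (cube n) \<epsilon> n (idm n))" for \<epsilon>
  proof -
    have F: "face 1 1 \<epsilon> \<in> box_hom 0 1" using face_Suc_box_hom[of 1 0 \<epsilon>] by simp
    \<comment> \<open>With \<alpha> an identity and \<beta> an end of the interval, the face in
      direction n + 1 becomes the end inclusion.\<close>
    have "((n, 1, compose (vert n) (box_tensor n 0 (idm n) (face 1 1 \<epsilon>)) (idm n), idm n, idm 1),
      (n, 0, idm n, act (cube n) n n (idm n) (idm n), act (cube 1) 0 1 (face 1 1 \<epsilon>) (idm 1)))
      \<in> tensor_rel (cube n) (cube 1) n"
      unfolding tensor_rel_def using F
      by (intro CollectI exI conjI) (rule refl | simp del: One_nat_def)+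
    moreover have "compose (vert n) (box_tensor n 0 (idm n) (face 1 1 \<epsilon>)) (idm n) = face (Suc n) (Suc n) \<epsilon>"
      using box_tensor_face_right[of 1 1 n \<epsilon>] compose_idm_right[OF face_Suc_box_hom, of "Suc n" n \<epsilon>] by simp
    ultimately have "T n (face (Suc n) (Suc n) \<epsilon>) = end_incl (cube n) \<epsilon> n (idm n)"
      unfolding T_def end_incl_def using tensor_class_eq compose_idm_left[OF F]
        compose_idm_left[OF idm_box_hom[of n]]
      by (metis act_cube)
    then show ?thesis using act_h[OF face_Suc_box_hom] by simp
  qed
  ultimately show ?thesis
    unfolding edge_rel_loops_iff[OF P] using Hend by (intro bexI[of _ h]) (auto simp: top_cell_def)
qed

lemma edge_rel_imp_sphere_htpy:
  assumes P: "pointed (X, x)" and f: "f \<in> sphere_maps n (X, x)" and g: "g \<in> sphere_maps n (X, x)"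
    and E: "(top_cell n f, top_cell n g) \<in> edge_rel (fst (loops n (X, x)))"
  shows "(f, g) \<in> sphere_htpy n (X, x)"
proof -
  have X: "cubical_set X" and x: "x \<in> cells X 0" using P by (auto simp: pointed_def)
  let ?A = "cube n" and ?I = "cube 1"
  let ?G = "geom_prod ?A ?I"
  obtain h where h: "h \<in> cells X (Suc n)"
    and hi: "\<And>i \<epsilon>. i \<in> {1..n} \<Longrightarrow> act X n (Suc n) (face (Suc n) i \<epsilon>) h = const_cell (X, x) n"
    and h0: "act X n (Suc n) (face (Suc n) (Suc n) False) h = top_cell n f"
    and h1: "act X n (Suc n) (face (Suc n) (Suc n) True) h = top_cell n g"
    using E unfolding edge_rel_loops_iff[OF P] by blast
  \<comment> \<open>The tuple is sent along the canonical map from the product to the (n + 1)-cube,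
    which is \<phi> followed by the product of \<open>c\<close> and \<open>d\<close>, and
    \<open>h\<close> is restricted to the result. Functoriality of the product gives equal values on
    generating pairs.\<close>
  define \<Phi> where "\<Phi> k = (\<lambda>(m, n', \<phi>, c, d). act X k (Suc n) (compose (vert k) (box_tensor m n' c d) \<phi>) h)" for k
  have inv: "\<Phi> k s = \<Phi> k t" if st: "(s, t) \<in> tensor_rel ?A ?I k" for s t k
  proof -
    obtain m m' l l' \<alpha> \<beta> \<phi> c d where
      s: "s = (m', l', compose (vert k) (box_tensor m l \<alpha> \<beta>) \<phi>, c, d)"
      and t: "t = (m, l, \<phi>, act ?A m m' \<alpha> c, act ?I l l' \<beta> d)"
      and mem: "\<alpha> \<in> box_hom m m'" "\<beta> \<in> box_hom l l'" "\<phi> \<in> box_hom k (m + l)"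
      using st unfolding tensor_rel_def by blast
    show ?thesis
      by (simp add: s t \<Phi>_def compose_assoc_box[OF mem(3), symmetric] box_tensor_compose[OF mem(1,2)])
  qed
  define H where "H k = (\<lambda>C\<in>cells ?G k. \<Phi> k (SOME t. t \<in> C))" for k
  have H: "H k (tensor_class ?A ?I k t) = \<Phi> k t" if "t \<in> pretensor ?A ?I k" for t k
  proof -
    have "t \<in> tensor_class ?A ?I k t" by (simp add: tensor_class_def)
    then have "(SOME s. s \<in> tensor_class ?A ?I k t) \<in> tensor_class ?A ?I k t" by (rule someI)
    then have "(t, SOME s. s \<in> tensor_class ?A ?I k t) \<in> gen_equiv (tensor_rel ?A ?I k)"
      unfolding tensor_class_def by (rule Image_singleton_iff[THEN iffD1])
    then have "\<Phi> k t = \<Phi> k (SOME s. s \<in> tensor_class ?A ?I k t)"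
      by (rule gen_equiv_invariant) (rule inv)
    moreover have "tensor_class ?A ?I k t \<in> cells ?G k"
      unfolding cells_geom_prod using that by (rule imageI)
    ultimately show ?thesis by (simp only: H_def restrict_apply')
  qed
  have arr: "compose (vert k) (box_tensor m l c d) \<phi> \<in> box_hom k (Suc n)"
    if "(m, l, \<phi>, c, d) \<in> pretensor ?A ?I k" for k m l \<phi> c d
    using that compose_box_hom[OF _ box_tensor_box_hom, of \<phi> k m l c n d 1] by (simp add: pretensor_def)
  have "H \<in> cmaps ?G X"
    unfolding cmaps_def
  proof (intro CollectI conjI allI ballI PiE_I)
    fix k C assume "C \<in> cells ?G k"
    then obtain m l \<phi> c d where t: "(m, l, \<phi>, c, d) \<in> pretensor ?A ?I k"
      and C: "C = tensor_class ?A ?I k (m, l, \<phi>, c, d)"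
      unfolding cells_geom_prod by auto
    show "H k C \<in> cells X k"
      unfolding C H[OF t] by (simp add: \<Phi>_def act_cell[OF X arr[OF t] h])
  next
    fix k C assume "C \<notin> cells ?G k"
    then show "H k C = undefined" by (simp add: H_def)
  next
    fix j k \<psi> C assume \<psi>: "\<psi> \<in> box_hom j k" and "C \<in> cells ?G k"
    then obtain m l \<phi> c d where t: "(m, l, \<phi>, c, d) \<in> pretensor ?A ?I k"
      and C: "C = tensor_class ?A ?I k (m, l, \<phi>, c, d)"
      unfolding cells_geom_prod by auto
    have t': "(m, l, compose (vert j) \<phi> \<psi>, c, d) \<in> pretensor ?A ?I j"
      using t compose_box_hom[OF \<psi>, of \<phi>] by (simp add: pretensor_def)
    show "H j (act ?G j k \<psi> C) = act X j k \<psi> (H k C)"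
      unfolding C act_geom_prod[OF \<psi>] H[OF t] H[OF t']
      by (simp add: \<Phi>_def act_act[OF X \<psi> arr[OF t] h] compose_assoc_box[OF \<psi>])
  qed
  moreover have "H k ` cells (geom_prod_sub ?A (boundary n) ?I) k \<subseteq> cells (point_sub (X, x)) k" for k
  proof
    fix z assume "z \<in> H k ` cells (geom_prod_sub ?A (boundary n) ?I) k"
    then obtain m l \<phi> c d where z: "z = H k (tensor_class ?A ?I k (m, l, \<phi>, c, d))"
      and t: "(m, l, \<phi>, c, d) \<in> pretensor (boundary n) ?I k"
      by (auto simp: geom_prod_sub_def)
    from t obtain i \<epsilon> where i: "i \<in> {1..n}" and c: "c \<in> face_image n i \<epsilon> m"
      and \<phi>: "\<phi> \<in> box_hom k (m + l)" and d: "d \<in> box_hom l 1"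
      by (auto simp: pretensor_def)
    obtain c' where c': "c' \<in> box_hom m (n - 1)" "c = compose (vert m) (face n i \<epsilon>) c'"
      using c by (auto simp: face_image_def)
    have F: "face (Suc n) i \<epsilon> \<in> box_hom n (Suc n)" using i by (intro face_Suc_box_hom) auto
    have n: "n - 1 + 1 = n" using i by simp
    have cd': "box_tensor m l c' d \<in> box_hom (m + l) n"
      using box_tensor_box_hom[OF c'(1) d] n by simp
    have "c \<in> box_hom m n" unfolding c'(2) by (rule compose_box_hom[OF c'(1) face_box_hom[OF i]])
    then have t': "(m, l, \<phi>, c, d) \<in> pretensor ?A ?I k" using \<phi> d by (simp add: pretensor_def)
    \<comment> \<open>If \<open>c\<close> factors through a face, so does its product with
      \<open>d\<close>, through the face of the same index one dimension higher; on that face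
      \<open>h\<close> is constant.\<close>
    have "box_tensor m l c d = compose (vert (m + l)) (face (Suc n) i \<epsilon>) (box_tensor m l c' d)"
      using box_tensor_compose[OF c'(1) d, of "face n i \<epsilon>" "idm 1"] compose_idm_left[OF d]
        box_tensor_face_left[OF i, of 1 \<epsilon>] c'(2) by simp
    then have "z = act X k (Suc n) (compose (vert k) (face (Suc n) i \<epsilon>)
        (compose (vert k) (box_tensor m l c' d) \<phi>)) h"
      unfolding z H[OF t'] by (simp add: \<Phi>_def compose_assoc_box[OF \<phi>])
    also have "\<dots> = const_cell (X, x) k"
      unfolding act_act[OF X compose_box_hom[OF \<phi> cd'] F h, symmetric] hi[OF i]
      by (rule act_const_cell[OF X x compose_box_hom[OF \<phi> cd']])
    finally show "z \<in> cells (point_sub (X, x)) k" by (simp add: point_sub_def)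
  qed
  moreover have Hend: "H k (end_incl ?A \<epsilon> k c) = act X k n c (act X n (Suc n) (face (Suc n) (Suc n) \<epsilon>) h)"
    if c: "c \<in> box_hom k n" for k c \<epsilon>
  proof -
    have F: "face 1 1 \<epsilon> \<in> box_hom 0 1" using face_Suc_box_hom[of 1 0 \<epsilon>] by simp
    have t: "(k, 0, idm k, c, face 1 1 \<epsilon>) \<in> pretensor ?A ?I k" using c F by (simp add: pretensor_def)
    have c0: "box_tensor k 0 c (idm 0) = c"
      using c box_hom_length[OF c] by (intro vert_ext[of _ k]) (auto simp: box_tensor_def idm_def)
    \<comment> \<open>The second factor has domain \<open>[1]^0\<close>, so the product merely
      appends \<epsilon> to the values of \<open>c\<close>.\<close>
    have "box_tensor k 0 c (face 1 1 \<epsilon>) = compose (vert k) (face (Suc n) (Suc n) \<epsilon>) c"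
      using box_tensor_compose[OF c idm_box_hom[of 0], of "idm n" "face 1 1 \<epsilon>"] compose_idm_left[OF c]
        compose_idm_right[OF F] box_tensor_face_right[of 1 1 n \<epsilon>] c0 by simp
    moreover have "compose (vert k) (compose (vert k) (face (Suc n) (Suc n) \<epsilon>) c) (idm k)
        = compose (vert k) (face (Suc n) (Suc n) \<epsilon>) c"
      by (intro compose_idm_right[of _ _ "Suc n"] compose_box_hom[OF c] face_Suc_box_hom) simp
    ultimately have "\<Phi> k (k, 0, idm k, c, face 1 1 \<epsilon>) = act X k (Suc n) (compose (vert k) (face (Suc n) (Suc n) \<epsilon>) c) h"
      by (simp add: \<Phi>_def)
    also have "\<dots> = act X k n c (act X n (Suc n) (face (Suc n) (Suc n) \<epsilon>) h)"
      using act_act[OF X c face_Suc_box_hom h] by simp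
    finally show ?thesis unfolding end_incl_def H[OF t] .
  qed
  moreover have "H k (end_incl ?A False k c) = f k c" "H k (end_incl ?A True k c) = g k c"
    if c: "c \<in> box_hom k n" for k c
    using f g cmaps_cube_apply[of f n X, OF _ c] cmaps_cube_apply[of g n X, OF _ c]
    by (simp_all only: Hend[OF c] h0 h1 sphere_maps_iff)
  ultimately have "H \<in> rel_homotopies ?A (boundary n) X (point_sub (X, x)) f g"
    by (simp add: rel_homotopies_def rel_maps_def)
  then show ?thesis using f g unfolding sphere_htpy_def rel_htpy_def sphere_maps_def by auto
qed

section \<open>Transfer from the edge relation to relative homotopy classes\<close>

lemma sphere_htpy_conv:
  assumes "pointed (X, x)"
  shows "sphere_htpy n (X, x) = {(f, g). f \<in> sphere_maps n (X, x) \<and> g \<in> sphere_maps n (X, x) \<and>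
    (top_cell n f, top_cell n g) \<in> edge_rel (fst (loops n (X, x)))}"
proof -
  have "sphere_htpy n (X, x) \<subseteq> sphere_maps n (X, x) \<times> sphere_maps n (X, x)"
    by (auto simp: sphere_htpy_def rel_htpy_def sphere_maps_def)
  then show ?thesis using sphere_htpy_imp_edge_rel[OF assms] edge_rel_imp_sphere_htpy[OF assms] by blast
qed

lemma equiv_sphere_htpy:
  assumes "Kan_complex X" and P: "pointed (X, x)"
  shows "equiv (sphere_maps n (X, x)) (sphere_htpy n (X, x))"
proof -
  have E: "equiv (cells (fst (loops n (X, x))) 0) (edge_rel (fst (loops n (X, x))))"
    by (rule equiv_edge_rel_loops[OF assms])
  note top = top_cell_sphere_map[OF P, of _ n]
  show ?thesis
  proof (rule equivI)
    show "sphere_htpy n (X, x) \<subseteq> sphere_maps n (X, x) \<times> sphere_maps n (X, x)"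
      by (auto simp: sphere_htpy_conv[OF P])
    show "refl_on (sphere_maps n (X, x)) (sphere_htpy n (X, x))"
      using equiv_class_eq_iff[OF E] top by (auto simp: sphere_htpy_conv[OF P] refl_on_def)
    show "sym (sphere_htpy n (X, x))"
      using E unfolding sphere_htpy_conv[OF P] equiv_def sym_def by blast
    show "trans (sphere_htpy n (X, x))"
      using E unfolding sphere_htpy_conv[OF P] equiv_def trans_def by blast
  qed
qed

lemma pi0_class_top_cell_eq_iff:
  assumes Kan: "Kan_complex X" and P: "pointed (X, x)"
    and f: "f \<in> sphere_maps n (X, x)" and g: "g \<in> sphere_maps n (X, x)"
  shows "pi0_class (fst (loops n (X, x))) (0, top_cell n f) = pi0_class (fst (loops n (X, x))) (0, top_cell n g)
    \<longleftrightarrow> (f, g) \<in> sphere_htpy n (X, x)"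
  using pi0_class_eq_edge_rel[OF cubical_set_loops[OF P] equiv_edge_rel_loops[OF Kan P]
      top_cell_sphere_map[OF P f] top_cell_sphere_map[OF P g]] f g
  by (simp add: sphere_htpy_conv[OF P])

lemma comparison_class:
  assumes Kan: "Kan_complex X" and P: "pointed (X, x)" and f: "f \<in> sphere_maps n (X, x)"
  shows "comparison n (X, x) (sphere_htpy n (X, x) `` {f}) = pi0_class (fst (loops n (X, x))) (0, top_cell n f)"
  unfolding comparison_def
proof (rule UN_constant_eq)
  show "f \<in> sphere_htpy n (X, x) `` {f}"
    using equiv_class_self[OF equiv_sphere_htpy[OF Kan P] f] .
  show "\<forall>g\<in>sphere_htpy n (X, x) `` {f}. pi0_class (fst (loops n (X, x))) (0, top_cell n g)
      = pi0_class (fst (loops n (X, x))) (0, top_cell n f)"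
  proof
    fix g assume "g \<in> sphere_htpy n (X, x) `` {f}"
    then have fg: "(f, g) \<in> sphere_htpy n (X, x)" and g: "g \<in> sphere_maps n (X, x)"
      by (auto simp: sphere_htpy_conv[OF P])
    then show "pi0_class (fst (loops n (X, x))) (0, top_cell n g) = pi0_class (fst (loops n (X, x))) (0, top_cell n f)"
      using pi0_class_top_cell_eq_iff[OF Kan P f g] by presburger
  qed
qed

lemma sphere_classes_eq_image:
  "sphere_classes n P = (\<lambda>f. sphere_htpy n P `` {f}) ` sphere_maps n P"
  by (auto simp: sphere_classes_def rel_classes_def sphere_maps_def sphere_htpy_def quotient_def)

text \<open>Injectivity is the agreement of the edge relation with equality in \<open>pi0\<close>;
  for surjectivity, every component contains a 0-cube and every 0-cube of the loop space is a top
  cell.\<close>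

lemma comparison_bij:
  assumes Kan: "Kan_complex X" and P: "pointed (X, x)"
  shows "bij_betw (comparison n (X, x)) (sphere_classes n (X, x)) (pi_n n (X, x))"
  unfolding bij_betw_def
proof
  show "inj_on (comparison n (X, x)) (sphere_classes n (X, x))"
  proof (rule inj_onI)
    fix F G assume "F \<in> sphere_classes n (X, x)" "G \<in> sphere_classes n (X, x)"
      and eq: "comparison n (X, x) F = comparison n (X, x) G"
    then obtain f g where f: "f \<in> sphere_maps n (X, x)" "F = sphere_htpy n (X, x) `` {f}"
      and g: "g \<in> sphere_maps n (X, x)" "G = sphere_htpy n (X, x) `` {g}"
      unfolding sphere_classes_eq_image by blast
    have "(f, g) \<in> sphere_htpy n (X, x)"
      using eq unfolding f(2) g(2) comparison_class[OF Kan P f(1)] comparison_class[OF Kan P g(1)]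
        pi0_class_top_cell_eq_iff[OF Kan P f(1) g(1)] .
    then show "F = G" unfolding f(2) g(2) by (rule equiv_class_eq[OF equiv_sphere_htpy[OF Kan P]])
  qed
  have "comparison n (X, x) ` sphere_classes n (X, x)
    = (\<lambda>a. pi0_class (fst (loops n (X, x))) (0, a)) ` top_cell n ` sphere_maps n (X, x)"
    unfolding sphere_classes_eq_image image_image
    by (rule image_cong) (simp_all add: comparison_class[OF Kan P])
  also have "\<dots> = pi_n n (X, x)"
    unfolding pi_n_def pi0_eq_image[OF cubical_set_loops[OF P]] bij_betw_imp_surj_on[OF top_cell_bij[OF P]] ..
  finally show "comparison n (X, x) ` sphere_classes n (X, x) = pi_n n (X, x)" .
qed


section \<open>Naturality\<close>

text \<open>\<open>loop_map\<close> only restricts domains, and a k-cube of the next loop space is a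
  (k + 1)-cube of the present one, so iteration keeps the value of \<open>p\<close> in dimension n +
  k.\<close>

lemma loops_map_apply:
  "c \<in> cells (fst (loops n (X, x))) k \<Longrightarrow> loops_map n (X, x) p k c = p (n + k) c"
proof (induction n arbitrary: k)
  case (Suc n)
  then have "c \<in> cells (fst (loops n (X, x))) (Suc k)" by (simp add: loops_Suc cells_loop)
  then show ?case using Suc by (simp add: loop_map_def loops_Suc)
qed simp

lemma loops_map_cell:
  assumes P: "pointed (X, x)" and Q: "pointed (Y, y)" and p: "p \<in> pointed_maps (X, x) (Y, y)"
    and c: "c \<in> cells (fst (loops n (X, x))) k"
  shows "p (n + k) c \<in> cells (fst (loops n (Y, y))) k"
proof -
  have x: "x \<in> cells X 0" using P by (simp add: pointed_def)
  have pm: "p \<in> cmaps X Y" and y: "p 0 x = y" using p by (auto simp: pointed_maps_def)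
  have cX: "c \<in> cells X (n + k)" using c by (simp add: cells_loops[OF P])
  have "act Y (n + k - 1) (n + k) (face (n + k) i \<epsilon>) (p (n + k) c) = const_cell (Y, y) (n + k - 1)"
    if i: "i \<in> {1..n}" for i \<epsilon>
  proof -
    have "i \<in> {1..n + k}" using i by simp
    from cmaps_act[OF pm face_box_hom[OF this] cX, symmetric] show ?thesis
      using c i const_cell_map[OF pm x] by (simp add: cells_loops[OF P] y)
  qed
  then show ?thesis using cmaps_cell[OF pm cX] by (simp add: cells_loops[OF Q])
qed

lemma cmap_comp_sphere_map:
  assumes P: "pointed (X, x)" and p: "p \<in> pointed_maps (X, x) (Y, y)" and f: "f \<in> sphere_maps n (X, x)"
  shows "cmap_comp (cube n) p f \<in> sphere_maps n (Y, y)"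
proof -
  have x: "x \<in> cells X 0" using P by (simp add: pointed_def)
  have pm: "p \<in> cmaps X Y" and y: "p 0 x = y" using p by (auto simp: pointed_maps_def)
  have fm: "f \<in> cmaps (cube n) X" using f by (simp add: sphere_maps_iff)
  have fc: "f k c \<in> cells X k" if "c \<in> box_hom k n" for k c
    using cmaps_cell[OF fm] that by simp
  have "cmap_comp (cube n) p f \<in> cmaps (cube n) Y"
    unfolding cmaps_def
  proof (intro CollectI conjI allI ballI PiE_I)
    fix m k \<phi> c assume \<phi>: "\<phi> \<in> box_hom m k" and c: "c \<in> cells (cube n) k"
    have "compose (vert m) c \<phi> \<in> box_hom m n" using compose_box_hom[OF \<phi>] c by simp
    moreover have "f m (compose (vert m) c \<phi>) = act X m k \<phi> (f k c)"
      using cmaps_act[OF fm \<phi> c] by simp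
    ultimately show "cmap_comp (cube n) p f m (act (cube n) m k \<phi> c) = act Y m k \<phi> (cmap_comp (cube n) p f k c)"
      using c cmaps_act[OF pm \<phi> fc] by (simp add: cmap_comp_def compose_def)
  qed (auto simp: cmap_comp_def compose_def intro: cmaps_cell[OF pm] fc)
  moreover have "cmap_comp (cube n) p f k c = const_cell (Y, y) k"
    if "i \<in> {1..n}" "c \<in> face_image n i \<epsilon> k" for k i \<epsilon> c
  proof -
    have "c \<in> box_hom k n"
      using that compose_box_hom[OF _ face_box_hom[OF that(1)]] by (auto simp: face_image_def)
    moreover have "f k c = const_cell (X, x) k" using f that unfolding sphere_maps_iff by blast
    ultimately show ?thesis
      using const_cell_map[OF pm x] y by (simp add: cmap_comp_def compose_def)
  qed
  ultimately show ?thesis unfolding sphere_maps_iff by blast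
qed

lemma top_cell_cmap_comp: "top_cell n (cmap_comp (cube n) p f) = p n (top_cell n f)"
  by (simp add: top_cell_def cmap_comp_def compose_def)

lemma edge_rel_map:
  assumes P: "pointed (X, x)" and Q: "pointed (Y, y)" and p: "p \<in> pointed_maps (X, x) (Y, y)"
    and ab: "(a, b) \<in> edge_rel (fst (loops n (X, x)))"
  shows "(p n a, p n b) \<in> edge_rel (fst (loops n (Y, y)))"
proof -
  have pm: "p \<in> cmaps X Y" using p by (simp add: pointed_maps_def)
  let ?L = "fst (loops n (X, x))" and ?M = "fst (loops n (Y, y))"
  have F: "face 1 1 \<epsilon> \<in> box_hom 0 1" for \<epsilon> using face_Suc_box_hom[of 1 0 \<epsilon>] by simp
  obtain h where h: "h \<in> cells ?L 1" "a = act ?L 0 1 (face 1 1 False) h" "b = act ?L 0 1 (face 1 1 True) h"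
    using ab by (auto simp: edge_rel_def)
  have hX: "h \<in> cells X (n + 1)" using h(1) unfolding cells_loops[OF P] by blast
  have "p n (act ?L 0 1 (face 1 1 \<epsilon>) h) = act ?M 0 1 (face 1 1 \<epsilon>) (p (n + 1) h)" for \<epsilon>
    using cmaps_act[OF pm box_tensor_idm_left[OF F, of n] hX]
    unfolding act_loops[OF F] by simp
  then show ?thesis
    unfolding edge_rel_def h(2,3) using loops_map_cell[OF P Q p h(1)] by auto
qed

text \<open>The union runs over all representatives; \<open>p\<close> sends an edge between top
  cells to such an edge, so all of them yield the same class.\<close>

lemma sphere_classes_map_class:
  assumes Kan: "Kan_complex Y" and P: "pointed (X, x)" and Q: "pointed (Y, y)"
    and p: "p \<in> pointed_maps (X, x) (Y, y)" and f: "f \<in> sphere_maps n (X, x)"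
    and ff: "(f, f) \<in> sphere_htpy n (X, x)"
  shows "sphere_classes_map n (Y, y) p (sphere_htpy n (X, x) `` {f})
    = sphere_htpy n (Y, y) `` {cmap_comp (cube n) p f}"
  unfolding sphere_classes_map_def
proof (rule UN_constant_eq)
  show "f \<in> sphere_htpy n (X, x) `` {f}" using ff by simp
  show "\<forall>g\<in>sphere_htpy n (X, x) `` {f}. sphere_htpy n (Y, y) `` {cmap_comp (cube n) p g}
      = sphere_htpy n (Y, y) `` {cmap_comp (cube n) p f}"
  proof
    fix g assume "g \<in> sphere_htpy n (X, x) `` {f}"
    then have g: "g \<in> sphere_maps n (X, x)"
      and fg: "(top_cell n f, top_cell n g) \<in> edge_rel (fst (loops n (X, x)))"
      by (auto simp: sphere_htpy_conv[OF P])
    have "(cmap_comp (cube n) p f, cmap_comp (cube n) p g) \<in> sphere_htpy n (Y, y)"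
      using edge_rel_map[OF P Q p fg] cmap_comp_sphere_map[OF P p f] cmap_comp_sphere_map[OF P p g]
      by (simp add: sphere_htpy_conv[OF Q] top_cell_cmap_comp)
    then show "sphere_htpy n (Y, y) `` {cmap_comp (cube n) p g} = sphere_htpy n (Y, y) `` {cmap_comp (cube n) p f}"
      by (rule equiv_class_eq[OF equiv_sphere_htpy[OF Kan Q], symmetric])
  qed
qed

lemma pi_n_map_class:
  assumes P: "pointed (X, x)" and Q: "pointed (Y, y)" and p: "p \<in> pointed_maps (X, x) (Y, y)"
    and a: "a \<in> cells (fst (loops n (X, x))) 0"
  shows "pi_n_map n (X, x) (Y, y) p (pi0_class (fst (loops n (X, x))) (0, a))
    = pi0_class (fst (loops n (Y, y))) (0, p n a)"
proof -
  have pm: "p \<in> cmaps X Y" using p by (simp add: pointed_maps_def)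
  let ?L = "fst (loops n (X, x))" and ?M = "fst (loops n (Y, y))"
  have "pi0_map ?M (loops_map n (X, x) p) (pi0_class ?L (0, a)) = pi0_class ?M (0, loops_map n (X, x) p 0 a)"
  proof (rule pi0_map_class)
    fix j k \<phi> c assume \<phi>: "\<phi> \<in> box_hom j k" and c: "c \<in> cells ?L k"
    have cX: "c \<in> cells X (n + k)" using c unfolding cells_loops[OF P] by blast
    have "loops_map n (X, x) p j (act ?L j k \<phi> c) = p (n + j) (act ?L j k \<phi> c)"
      by (rule loops_map_apply[OF act_cell[OF cubical_set_loops[OF P] \<phi> c]])
    also have "\<dots> = act ?M j k \<phi> (p (n + k) c)"
      unfolding act_loops[OF \<phi>] by (rule cmaps_act[OF pm box_tensor_idm_left[OF \<phi>] cX])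
    finally show "loops_map n (X, x) p j (act ?L j k \<phi> c) = act ?M j k \<phi> (loops_map n (X, x) p k c)"
      by (simp add: loops_map_apply[OF c])
  next
    fix k c assume c: "c \<in> cells ?L k"
    show "loops_map n (X, x) p k c \<in> cells ?M k"
      unfolding loops_map_apply[OF c] by (rule loops_map_cell[OF P Q p c])
  qed
  then show ?thesis by (simp add: pi_n_map_def loops_map_apply[OF a])
qed

theorem corollary3p16:
  fixes X :: "'a cset" and x :: 'a and n :: nat
  assumes "Kan_complex X" and "pointed (X, x)"
  shows
    "bij_betw (top_cell n) (sphere_maps n (X, x)) (cells (fst (loops n (X, x))) 0)
     \<and> equiv (sphere_maps n (X, x)) (sphere_htpy n (X, x))
     \<and> (\<forall>f\<in>sphere_maps n (X, x).
          comparison n (X, x) (sphere_htpy n (X, x) `` {f})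
            = pi0_class (fst (loops n (X, x))) (0, top_cell n f))
     \<and> bij_betw (comparison n (X, x)) (sphere_classes n (X, x)) (pi_n n (X, x))
     \<and> (\<forall>(Y :: 'b cset) y p. Kan_complex Y \<and> pointed (Y, y) \<and> p \<in> pointed_maps (X, x) (Y, y) \<longrightarrow>
          (\<forall>f\<in>sphere_maps n (X, x).
             top_cell n (cmap_comp (cube n) p f) = loops_map n (X, x) p 0 (top_cell n f))
          \<and> (\<forall>f\<in>sphere_maps n (X, x).
             sphere_classes_map n (Y, y) p (sphere_htpy n (X, x) `` {f})
               = sphere_htpy n (Y, y) `` {cmap_comp (cube n) p f})
          \<and> (\<forall>F\<in>sphere_classes n (X, x).
             comparison n (Y, y) (sphere_classes_map n (Y, y) p F)
               = pi_n_map n (X, x) (Y, y) p (comparison n (X, x) F)))"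
proof (intro conjI ballI allI impI)
  note Kan = assms(1) and P = assms(2)
  show "bij_betw (top_cell n) (sphere_maps n (X, x)) (cells (fst (loops n (X, x))) 0)"
    by (rule top_cell_bij[OF P])
  show "equiv (sphere_maps n (X, x)) (sphere_htpy n (X, x))"
    by (rule equiv_sphere_htpy[OF Kan P])
  show "bij_betw (comparison n (X, x)) (sphere_classes n (X, x)) (pi_n n (X, x))"
    by (rule comparison_bij[OF Kan P])
  fix f assume f: "f \<in> sphere_maps n (X, x)"
  show "comparison n (X, x) (sphere_htpy n (X, x) `` {f}) = pi0_class (fst (loops n (X, x))) (0, top_cell n f)"
    by (rule comparison_class[OF Kan P f])
next
  note Kan = assms(1) and P = assms(2)
  fix Y :: "'b cset" and y p
  assume "Kan_complex Y \<and> pointed (Y, y) \<and> p \<in> pointed_maps (X, x) (Y, y)"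
  then have KanY: "Kan_complex Y" and Q: "pointed (Y, y)" and p: "p \<in> pointed_maps (X, x) (Y, y)"
    by auto
  have class_map: "sphere_classes_map n (Y, y) p (sphere_htpy n (X, x) `` {f})
      = sphere_htpy n (Y, y) `` {cmap_comp (cube n) p f}" if f: "f \<in> sphere_maps n (X, x)" for f
  proof (rule sphere_classes_map_class[OF KanY P Q p f])
    show "(f, f) \<in> sphere_htpy n (X, x)"
      using equiv_class_self[OF equiv_sphere_htpy[OF Kan P] f] by simp
  qed
  {
    fix f assume f: "f \<in> sphere_maps n (X, x)"
    show "top_cell n (cmap_comp (cube n) p f) = loops_map n (X, x) p 0 (top_cell n f)"
      using loops_map_apply[OF top_cell_sphere_map[OF P f], of p] by (simp add: top_cell_cmap_comp)
    show "sphere_classes_map n (Y, y) p (sphere_htpy n (X, x) `` {f})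
      = sphere_htpy n (Y, y) `` {cmap_comp (cube n) p f}"
      by (rule class_map[OF f])
  }
  \<comment> \<open>On a representative \<open>f\<close> both routes end at the component of
    \<open>p n (top_cell n f)\<close>.\<close>
  fix F assume "F \<in> sphere_classes n (X, x)"
  then obtain f where f: "f \<in> sphere_maps n (X, x)" and F: "F = sphere_htpy n (X, x) `` {f}"
    unfolding sphere_classes_eq_image by blast
  show "comparison n (Y, y) (sphere_classes_map n (Y, y) p F)
      = pi_n_map n (X, x) (Y, y) p (comparison n (X, x) F)"
    unfolding F class_map[OF f] comparison_class[OF Kan P f]
      comparison_class[OF KanY Q cmap_comp_sphere_map[OF P p f]]
      pi_n_map_class[OF P Q p top_cell_sphere_map[OF P f]] top_cell_cmap_comp ..
qed

end
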